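(* Let $s > t \ge 1$ and $k \ge 4$ be fixed integers. There exists $n_2 = n_2(k,s,t)$ such that the following holds for all $n \ge n_2$ with $s > 2R_k(n,s,t)$. If $G$ is a graph on $n$ vertices with $t_{k-1}(n)+t$ edges and $\tau_k(G) = s$, then $$N_k(G) \ge s\cdot (n^{-}_{k,s,t})^{k-2}.$$ Moreover, if $n^{-}_{k,s,t} \in \mathbb{N}$, then equality holds if and only if $G \cong KM(n,k,s,t)$.
   Context: For a graph $G$, $N_k(G)$ is the number of copies of $K_k$ in $G$, and $\tau_k(G)$ is the minimum size of a set $S\subseteq V(G)$ meeting every copy of $K_k$ in $G$. $t_{k-1}(n)$ is the number of edges of the Turán graph $T_{k-1}(n)$. Let $r_{n,k} = n - (k-1)\lfloor n/(k-1)\rfloor$. Define $$R_k(n,s,t) = \left(\frac{2(k-1)(s-t) + (k-1-r_{n,k})r_{n,k}}{k-2}\right)^{1/2},\quad n^{+}_{k,s,t} = \frac{n + (k-2)R_k(n,s,t)}{k-1},\quad n^{-}_{k,s,t} = \frac{n - R_k(n,s,t)}{k-1}.$$ When $n^{-}_{k,s,t}\in\mathbb{N}$, let $V_1\cup\cdots\cup V_{k-1}$ be a partition of an $n$-set with $|V_1| = n^{+}_{k,s,t}$ and $|V_i| = n^{-}_{k,s,t}$ for $2\le i\le k-1$, and let $KM(n,k,s,t)$ be the graph obtained from the complete $(k-1)$-partite graph with parts $V_1,\ldots,V_{k-1}$ by taking distinct vertices $u_1,\ldots,u_s,v_1,\ldots,v_s \in V_1$ and adding the edges $u_1v_1,\ldots,u_sv_s$.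 *)

theory Defs
  imports Complex_Main "HOL-Library.Ramsey"
begin

record 'a ugraph =
  verts :: "'a set"
  edges :: "'a set set"

definition simple_graph :: "'a ugraph \<Rightarrow> bool" where
  "simple_graph G \<longleftrightarrow> finite (verts G) \<and> edges G \<subseteq> [verts G]\<^bsup>2\<^esup>"

definition graph_iso :: "'a ugraph \<Rightarrow> 'b ugraph \<Rightarrow> bool" where
  "graph_iso G H \<longleftrightarrow> (\<exists>f. bij_betw f (verts G) (verts H) \<and>
     (\<forall>x\<in>verts G. \<forall>y\<in>verts G. {x, y} \<in> edges G \<longleftrightarrow> {f x, f y} \<in> edges H))"

text \<open>A copy of \<open>K\<^sub>k\<close> (as a subgraph) is determined by its vertex set, so copies are
  identified with the \<open>k\<close>-element cliques.\<close>

definition clique_copies :: "nat \<Rightarrow> 'a ugraph \<Rightarrow> 'a set set" where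
  "clique_copies k G = {W \<in> [verts G]\<^bsup>k\<^esup>. clique W (edges G)}"

definition N_cliques :: "nat \<Rightarrow> 'a ugraph \<Rightarrow> nat" where
  "N_cliques k G = card (clique_copies k G)"

definition \<tau> :: "nat \<Rightarrow> 'a ugraph \<Rightarrow> nat" where
  "\<tau> k G = (LEAST m. \<exists>S. S \<subseteq> verts G \<and> card S = m \<and> (\<forall>W\<in>clique_copies k G. S \<inter> W \<noteq> {}))"

text \<open>Vertex \<open>(i, j)\<close> is the \<open>j\<close>-th vertex of part \<open>i\<close>; there are \<open>p\<close> parts, and part \<open>i\<close>
  has size \<open>c i\<close>.\<close>

definition complete_multipartite :: "nat \<Rightarrow> (nat \<Rightarrow> nat) \<Rightarrow> (nat \<times> nat) ugraph" where
  "complete_multipartite p c =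
     (let V = (SIGMA i:{..<p}. {..<c i})
      in \<lparr>verts = V, edges = {{x, y} | x y. x \<in> V \<and> y \<in> V \<and> fst x \<noteq> fst y}\<rparr>)"

definition turan_graph :: "nat \<Rightarrow> nat \<Rightarrow> (nat \<times> nat) ugraph" where
  "turan_graph p n =
     complete_multipartite p (\<lambda>i. n div p + (if i < n mod p then 1 else 0))"

definition turan_number :: "nat \<Rightarrow> nat \<Rightarrow> nat" where
  "turan_number p n = card (edges (turan_graph p n))"

definition r_rem :: "nat \<Rightarrow> nat \<Rightarrow> nat" where
  "r_rem n k = n - (k - 1) * (n div (k - 1))"

definition R :: "nat \<Rightarrow> nat \<Rightarrow> nat \<Rightarrow> nat \<Rightarrow> real" where
  "R k n s t = sqrt ((2 * (real k - 1) * (real s - real t)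
     + (real k - 1 - real (r_rem n k)) * real (r_rem n k)) / (real k - 2))"

definition n_plus :: "nat \<Rightarrow> nat \<Rightarrow> nat \<Rightarrow> nat \<Rightarrow> real" where
  "n_plus k n s t = (real n + (real k - 2) * R k n s t) / (real k - 1)"

definition n_minus :: "nat \<Rightarrow> nat \<Rightarrow> nat \<Rightarrow> nat \<Rightarrow> real" where
  "n_minus k n s t = (real n - R k n s t) / (real k - 1)"

text \<open>Only meaningful when \<open>n_minus k n s t \<in> \<nat>\<close> and \<open>2 * s \<le> n_plus k n s t\<close>. In that case
  \<open>n_plus k n s t = n - (k - 2) * n_minus k n s t\<close> is also a natural number, so the floors are
  exact, and the \<open>s\<close> added edges form a matching inside part \<open>0\<close>.\<close>

definition KM :: "nat \<Rightarrow> nat \<Rightarrow> nat \<Rightarrow> nat \<Rightarrow> (nat \<times> nat) ugraph" where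
  "KM n k s t =
     (let K = complete_multipartite (k - 1)
                (\<lambda>i. if i = 0 then nat \<lfloor>n_plus k n s t\<rfloor> else nat \<lfloor>n_minus k n s t\<rfloor>)
      in \<lparr>verts = verts K, edges = edges K \<union> {{(0, 2 * i), (0, 2 * i + 1)} | i. i < s}\<rparr>)"

end

theory Submission
  imports Defs
begin

text \<open>
  Write \<open>p = k - 1\<close>. Deleting the \<open>s\<close> vertices of a minimum cover leaves a \<open>K\<^sub>k\<close>-free graph that misses
  only \<open>O(n)\<close> edges of the Turan bound, so Fueredi's stability argument yields a colouring with \<open>p\<close> colours
  and \<open>O(n)\<close> monochromatic edges; take one with the fewest. If there are at most
  \<open>s (n\<^sup>-)\<^bsup>k-2\<^esup>\<close> copies of \<open>K\<^sub>k\<close>, then no vertex has linearly many monochromatic edges or linearly many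
  missing edges, and each monochromatic edge extends to about \<open>(n/p)\<^bsup>k-2\<^esup>\<close> copies, so there are at most \<open>s\<close>
  of them. Covering them covers all copies of \<open>K\<^sub>k\<close>, so they form a matching of size exactly \<open>s\<close>.

  Let \<open>d\<^sub>j\<close> be the deviation of the \<open>j\<close>-th class from \<open>n/p\<close> and \<open>M\<close> the number of ordered missing
  pairs. Counting edges gives \<open>M + (\<Sum>j. d\<^sub>j\<^sup>2) = (p - 1) R\<^sup>2 / p\<close>, hence \<open>d\<^sub>j \<le> (p - 1) R / p - M / (2 R)\<close>.
  To second order the number of copies is governed by \<open>X = M + \<Sum> d\<^sub>j\<close>, summed over the classes of the
  \<open>s\<close> monochromatic edges. The hypothesis \<open>s > 2 R\<close> guarantees that \<open>X\<close> attains its maximum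
  \<open>s (p - 1) R / p\<close> only when \<open>M = 0\<close> and every \<open>d\<^sub>j\<close> occurring is maximal, which is the extremal graph.
  Since \<open>p X\<close> is an integer and \<open>R\<close> depends only on \<open>n mod p\<close>, any smaller \<open>X\<close> is smaller by a
  constant, which dominates the error terms for large \<open>n\<close>.
\<close>

section \<open>Monochromatic edges and Fueredi stability\<close>

text \<open>Edges are counted as ordered pairs, here and in \<open>cross\<close> and
  \<open>missing\<close>, so that counts of Turan type become identities between naturals without
  halving.\<close>

definition arcs :: "'a set set \<Rightarrow> ('a \<times> 'a) set" where
  "arcs E = {(x, y). {x, y} \<in> E}"

definition mono_edges :: "'a set set \<Rightarrow> ('a \<Rightarrow> nat) \<Rightarrow> 'a set set" where
  "mono_edges E f = {e \<in> E. \<exists>i. f ` e \<subseteq> {i}}"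

definition cross :: "'a set \<Rightarrow> ('a \<Rightarrow> nat) \<Rightarrow> ('a \<times> 'a) set" where
  "cross V f = {(x, y) \<in> V \<times> V. f x \<noteq> f y}"

definition missing :: "'a set \<Rightarrow> 'a set set \<Rightarrow> ('a \<Rightarrow> nat) \<Rightarrow> ('a \<times> 'a) set" where
  "missing V E f = cross V f - arcs E"

lemma edgeE:
  assumes "E \<subseteq> [V]\<^bsup>2\<^esup>" "e \<in> E"
  obtains x y where "e = {x, y}" "x \<noteq> y" "x \<in> V" "y \<in> V"
  using assms by (auto simp: nsets_def card_2_iff subset_iff)

lemma edgeD:
  assumes "E \<subseteq> [V]\<^bsup>2\<^esup>" "{x, y} \<in> E"
  shows "x \<noteq> y" "x \<in> V" "y \<in> V"
  using assms by (auto simp: nsets_def subset_iff)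

lemma mono_edges_pair [simp]: "{x, y} \<in> mono_edges E f \<longleftrightarrow> {x, y} \<in> E \<and> f x = f y"
  by (auto simp: mono_edges_def)

lemma mono_edges_subset: "mono_edges E f \<subseteq> E"
  by (auto simp: mono_edges_def)

lemma arcs_subset: "E \<subseteq> [V]\<^bsup>2\<^esup> \<Longrightarrow> arcs E \<subseteq> V \<times> V"
  by (auto simp: arcs_def dest: edgeD)

lemma finite_arcs: "finite V \<Longrightarrow> E \<subseteq> [V]\<^bsup>2\<^esup> \<Longrightarrow> finite (arcs E)"
  by (rule finite_subset[OF arcs_subset]) auto

lemma finite_edges: "finite V \<Longrightarrow> E \<subseteq> [V]\<^bsup>2\<^esup> \<Longrightarrow> finite E"
  using finite_imp_finite_nsets finite_subset by metis

lemma finite_cross [simp]: "finite V \<Longrightarrow> finite (cross V f)"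
  by (rule finite_subset[of _ "V \<times> V"]) (auto simp: cross_def)

lemma finite_missing [simp]: "finite V \<Longrightarrow> finite (missing V E f)"
  by (auto simp: missing_def)

lemma card_arcs:
  assumes "finite V" "E \<subseteq> [V]\<^bsup>2\<^esup>"
  shows "card (arcs E) = 2 * card E"
proof -
  have eq: "{(x, y). {x, y} = {a, b}} = {(a, b), (b, a)}" for a b :: 'a
    by (auto simp: doubleton_eq_iff)
  have two: "card {(x, y). {x, y} = e} = 2 \<and> finite {(x, y). {x, y} = e}" if "e \<in> E" for e
    using assms(2) that by (elim edgeE) (auto simp: eq)
  have "arcs E = (\<Union>e\<in>E. {(x, y). {x, y} = e})"
    by (auto simp: arcs_def)
  also have "card \<dots> = (\<Sum>e\<in>E. card {(x, y). {x, y} = e})"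
    by (rule card_UN_disjoint) (use two finite_edges[OF assms] in auto)
  also have "\<dots> = 2 * card E"
    using two by simp
  finally show ?thesis .
qed

text \<open>Both sides equal the edges between different colours plus the monochromatic edges plus
  the missing pairs, all ordered.\<close>

lemma card_arcs_missing:
  assumes "finite V" "E \<subseteq> [V]\<^bsup>2\<^esup>"
  shows "card (arcs E) + card (missing V E f) = card (cross V f) + card (arcs (mono_edges E f))"
proof -
  let ?I = "cross V f \<inter> arcs E"
  have 1: "arcs E = ?I \<union> arcs (mono_edges E f)" "?I \<inter> arcs (mono_edges E f) = {}"
    using arcs_subset[OF assms(2)] by (auto simp: arcs_def cross_def)
  have 2: "cross V f = ?I \<union> missing V E f" "?I \<inter> missing V E f = {}"
    by (auto simp: missing_def)
  have fin: "finite ?I" "finite (arcs (mono_edges E f))" "finite (missing V E f)"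
    using assms finite_arcs[OF assms] 1(1) by (auto intro: rev_finite_subset)
  have "card (arcs E) = card ?I + card (arcs (mono_edges E f))"
    using card_Un_disjoint[OF fin(1,2) 1(2)] 1(1) by simp
  moreover have "card (cross V f) = card ?I + card (missing V E f)"
    using card_Un_disjoint[OF fin(1,3) 2(2)] 2(1) by simp
  ultimately show ?thesis by simp
qed

lemma card_cross:
  assumes "finite V" "f \<in> V \<rightarrow> {..<p}"
  shows "card (cross V f) + (\<Sum>j<p. (card {v\<in>V. f v = j})\<^sup>2) = (card V)\<^sup>2"
proof -
  let ?D = "\<lambda>j. {v\<in>V. f v = j} \<times> {v\<in>V. f v = j}"
  have "V \<times> V = cross V f \<union> (\<Union>j<p. ?D j)"
    using assms(2) by (auto simp: cross_def)
  moreover have "cross V f \<inter> (\<Union>j<p. ?D j) = {}"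
    by (auto simp: cross_def)
  moreover have "card (\<Union>j<p. ?D j) = (\<Sum>j<p. card (?D j))"
    by (rule card_UN_disjoint) (use assms in auto)
  ultimately have "card (V \<times> V) = card (cross V f) + (\<Sum>j<p. card (?D j))"
    using assms by (simp add: card_Un_disjoint)
  then show ?thesis
    by (simp add: card_cartesian_product power2_eq_square)
qed

lemma sum_card_parts:
  fixes f :: "'a \<Rightarrow> nat"
  assumes "finite V" "f \<in> V \<rightarrow> {..<p}"
  shows "(\<Sum>j<p. card {v\<in>V. f v = j}) = card V"
proof -
  have "V = (\<Union>j<p. {v\<in>V. f v = j})" using assms(2) by auto
  moreover have "card (\<Union>j<p. {v\<in>V. f v = j}) = (\<Sum>j<p. card {v\<in>V. f v = j})"
    by (rule card_UN_disjoint) (use assms in auto)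
  ultimately show ?thesis by simp
qed

text \<open>Fueredi's argument: split off the non-neighbours of a vertex of maximum degree.\<close>

lemma furedi_stability:
  assumes "finite V" "E \<subseteq> [V]\<^bsup>2\<^esup>" "\<And>W. W \<subseteq> V \<Longrightarrow> card W = Suc p \<Longrightarrow> \<not> clique W E"
  shows "\<exists>f \<in> V \<rightarrow> {..<p}. card (arcs E) + card (arcs (mono_edges E f)) \<le> card (cross V f)"
  using assms
proof (induction p arbitrary: V E)
  case 0
  have "V = {}"
  proof (rule ccontr)
    assume "V \<noteq> {}"
    then obtain v where "v \<in> V" by auto
    then show False using 0(3)[of "{v}"] by (auto simp: clique_def)
  qed
  then have "E = {}" using 0(2) by (auto simp: nsets_def)
  then show ?case using \<open>V = {}\<close> by (auto simp: arcs_def mono_edges_def)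
next
  case (Suc p)
  show ?case
  proof (cases "V = {}")
    case True
    then have "E = {}" using Suc.prems(2) by (auto simp: nsets_def)
    then show ?thesis using True by (auto simp: arcs_def mono_edges_def)
  next
    case False
    define nb where "nb x = {y. {x, y} \<in> E}" for x
    have nbV: "nb x \<subseteq> V" for x
      using Suc.prems(2) by (auto simp: nb_def dest: edgeD)
    \<comment> \<open>The vertex \<open>x\<close> has maximum degree. Its neighbourhood
      \<open>U\<close> keeps the first \<open>p\<close> colours, and the rest \<open>Z\<close>,
      which contains \<open>x\<close>, becomes the last class.\<close>
    have "Max ((\<lambda>x. card (nb x)) ` V) \<in> (\<lambda>x. card (nb x)) ` V"
      using Suc.prems(1) False by (intro Max_in) auto
    then obtain x where "x \<in> V" "card (nb x) = Max ((\<lambda>x. card (nb x)) ` V)" by auto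
    then have x: "x \<in> V" "\<And>y. y \<in> V \<Longrightarrow> card (nb y) \<le> card (nb x)"
      using Suc.prems(1) by auto
    define U where "U = nb x"
    define Z where "Z = V - U"
    define E' where "E' = {e \<in> E. e \<subseteq> U}"
    have UV: "U \<subseteq> V" "finite U" "finite Z" "V = U \<union> Z" "U \<inter> Z = {}"
      using nbV[of x] Suc.prems(1) finite_subset[OF nbV[of x]] by (auto simp: U_def Z_def)
    have E': "E' \<subseteq> [U]\<^bsup>2\<^esup>"
      using Suc.prems(2) by (auto simp: E'_def nsets_def)
    \<comment> \<open>Such a clique would be extended by \<open>x\<close>, so the induction
      hypothesis applies to \<open>U\<close> with one colour fewer.\<close>
    have "\<not> clique W E'" if W: "W \<subseteq> U" "card W = Suc p" for W
    proof
      assume c: "clique W E'"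
      have xU: "x \<notin> U" using edgeD(1)[OF Suc.prems(2), of x x] by (auto simp: U_def nb_def)
      have "clique (insert x W) E"
        using c W(1) by (auto simp: clique_def E'_def U_def nb_def insert_commute)
      moreover have "card (insert x W) = Suc (Suc p)"
        using W xU UV(2) finite_subset by (subst card_insert_disjoint) auto
      ultimately show False using Suc.prems(3)[of "insert x W"] W UV x(1) by auto
    qed
    from Suc.IH[OF UV(2) E' this] obtain g where g: "g \<in> U \<rightarrow> {..<p}"
      "card (arcs E') + card (arcs (mono_edges E' g)) \<le> card (cross U g)" by auto
    define f where "f v = (if v \<in> U then g v else p)" for v
    have fV: "f \<in> V \<rightarrow> {..<Suc p}" using g(1) by (auto simp: f_def Pi_def less_Suc_eq)
    have fZ: "f v = p" if "v \<in> Z" for v using that by (auto simp: f_def Z_def)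
    have fU: "f v = g v" "g v < p" if "v \<in> U" for v using that g(1) by (auto simp: f_def)
    let ?ZU = "arcs E \<inter> Z \<times> U" let ?ZZ = "arcs E \<inter> Z \<times> Z" let ?UZ = "arcs E \<inter> U \<times> Z"
    have cross: "cross V f = cross U g \<union> (U \<times> Z \<union> Z \<times> U)"
      using UV fZ fU by (fastforce simp: cross_def)
    have c1: "card (cross V f) = card (cross U g) + 2 * (card Z * card U)"
    proof -
      have "cross U g \<inter> (U \<times> Z \<union> Z \<times> U) = {}" "(U \<times> Z) \<inter> (Z \<times> U) = {}"
        using UV(5) by (auto simp: cross_def)
      then show ?thesis unfolding cross
        using UV by (simp add: card_Un_disjoint card_cartesian_product)
    qed
    have fin: "finite (arcs E)" by (rule finite_arcs[OF Suc.prems(1,2)])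
    have c2: "card (arcs E) = card (arcs E') + card ?UZ + card ?ZU + card ?ZZ"
    proof -
      have "arcs E = arcs E' \<union> (?UZ \<union> (?ZU \<union> ?ZZ))"
        using arcs_subset[OF Suc.prems(2)] UV by (auto simp: arcs_def E'_def)
      moreover have "arcs E' \<inter> (?UZ \<union> (?ZU \<union> ?ZZ)) = {}" "?UZ \<inter> (?ZU \<union> ?ZZ) = {}" "?ZU \<inter> ?ZZ = {}"
        using UV(5) by (auto simp: arcs_def E'_def)
      moreover have "finite (arcs E')" using finite_arcs[OF UV(2) E'] .
      ultimately show ?thesis using fin by (metis (no_types, lifting) ab_semigroup_add_class.add_ac(1)
         card_Un_disjoint finite_Int finite_Un)
    qed
    have c3: "card (arcs (mono_edges E f)) = card (arcs (mono_edges E' g)) + card ?ZZ"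
    proof -
      have "({a, b} \<in> E \<and> f a = f b) \<longleftrightarrow>
          ({a, b} \<in> E \<and> {a, b} \<subseteq> U \<and> g a = g b) \<or> ({a, b} \<in> E \<and> a \<in> Z \<and> b \<in> Z)" for a b
      proof (cases "{a, b} \<in> E")
        case True
        then have "a \<in> V" "b \<in> V" using edgeD[OF Suc.prems(2) True] by auto
        then show ?thesis using True fU[of a] fU[of b] fZ[of a] fZ[of b] UV(4,5) by auto
      qed simp
      then have "arcs (mono_edges E f) = arcs (mono_edges E' g) \<union> ?ZZ"
        unfolding arcs_def E'_def mono_edges_pair by blast
      moreover have "arcs (mono_edges E' g) \<inter> ?ZZ = {}"
        using UV(5) by (auto simp: arcs_def E'_def)
      moreover have "finite (arcs (mono_edges E' g))"
        by (rule finite_arcs[OF UV(2)]) (use E' mono_edges_subset in blast)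
      ultimately show ?thesis using fin by (simp add: card_Un_disjoint)
    qed
    have c4: "card ?UZ = card ?ZU"
    proof -
      have "bij_betw prod.swap ?UZ ?ZU"
        by (rule bij_betwI[where g = prod.swap]) (auto simp: arcs_def insert_commute)
      then show ?thesis by (rule bij_betw_same_card)
    qed
    \<comment> \<open>The left side is the sum of the degrees over \<open>Z\<close>, and the choice
      of \<open>x\<close> bounds each degree by \<open>card U\<close>.\<close>
    have c5: "card ?ZU + card ?ZZ \<le> card Z * card U"
    proof -
      have "card ?ZU + card ?ZZ = card (?ZU \<union> ?ZZ)"
        using fin UV(5) by (subst card_Un_disjoint) auto
      also have "?ZU \<union> ?ZZ = (SIGMA z:Z. nb z)"
        using nbV unfolding UV(4) by (auto simp: arcs_def nb_def)
      also have "card \<dots> = (\<Sum>z\<in>Z. card (nb z))"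
        using UV(3) finite_subset[OF nbV Suc.prems(1)] by (subst card_SigmaI) auto
      also have "\<dots> \<le> card Z * card U"
        using sum_bounded_above[of Z "\<lambda>z. card (nb z)" "card U"] x(2) UV by (auto simp: U_def)
      finally show ?thesis .
    qed
    \<comment> \<open>Arcs inside \<open>Z\<close> count as edges and again as monochromatic edges,
      and arcs between \<open>Z\<close> and \<open>U\<close> occur in both directions. The new terms
      on the left are thus twice the sum in \<open>c5\<close>, against
      \<open>2 * (card Z * card U)\<close> new crossing pairs.\<close>
    have "card (arcs E) + card (arcs (mono_edges E f)) \<le> card (cross V f)"
      using c1 c2 c3 c4 c5 g(2) by linarith
    then show ?thesis using fV by blast
  qed
qed

section \<open>Counting cliques with one vertex in each prescribed colour\<close>

text \<open>A choice function that is not a clique passes through both ends of a missing pair. Such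
  a pair fixes two coordinates and leaves at most \<open>card V\<close> choices for each of the
  others.\<close>

lemma card_transversals:
  fixes V :: "'a set"
  assumes "finite V" "finite J" "\<And>j. j \<in> J \<Longrightarrow> A j \<subseteq> {v\<in>V. f v = j}"
  shows "(\<Prod>j\<in>J. card (A j)) \<le>
    card {g \<in> Pi\<^sub>E J A. \<forall>i\<in>J. \<forall>j\<in>J. i \<noteq> j \<longrightarrow> {g i, g j} \<in> E}
      + card (missing V E f) * card V ^ (card J - 2)" (is "_ \<le> card ?T + _")
proof -
  have finA: "finite (A j)" "card (A j) \<le> card V" if "j \<in> J" for j
    using assms(3)[OF that] finite_subset[of "A j" V] assms(1) card_mono[of V "A j"] by auto
  have finP: "finite (Pi\<^sub>E J A)" using assms(2) finA by (intro finite_PiE) auto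
  \<comment> \<open>These are the choice functions spoilt by the pair. There are none if a colour of
    the pair lies outside \<open>J\<close>; otherwise \<open>J\<close> contains two distinct colours
    and \<open>card J - 2\<close> does not truncate.\<close>
  define H where "H = (\<lambda>(u, v). {g \<in> Pi\<^sub>E J A. f u \<in> J \<and> f v \<in> J \<and> g (f u) = u \<and> g (f v) = v})"
  have sub: "Pi\<^sub>E J A \<subseteq> ?T \<union> (\<Union>e\<in>missing V E f. H e)"
  proof
    fix g assume g: "g \<in> Pi\<^sub>E J A"
    have gf: "g j \<in> V" "f (g j) = j" if "j \<in> J" for j
      using g assms(3)[OF that] that by (auto simp: PiE_iff)
    show "g \<in> ?T \<union> (\<Union>e\<in>missing V E f. H e)"
    proof (cases "g \<in> ?T")
      case False
      then obtain i j where ij: "i \<in> J" "j \<in> J" "i \<noteq> j" "{g i, g j} \<notin> E" using g by auto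
      then have "(g i, g j) \<in> missing V E f" "g \<in> H (g i, g j)"
        using gf g by (auto simp: missing_def cross_def arcs_def H_def)
      then show ?thesis by blast
    qed auto
  qed
  have bd: "card (H e) \<le> card V ^ (card J - 2)" if "e \<in> missing V E f" for e
  proof -
    obtain u v where e: "e = (u, v)" by (cases e)
    with that have fuv: "f u \<noteq> f v" by (auto simp: missing_def cross_def)
    show ?thesis
    proof (cases "f u \<in> J \<and> f v \<in> J")
      case True
      let ?J = "J - {f u, f v}"
      have "inj_on (\<lambda>g. restrict g ?J) (H e)"
      proof (rule inj_onI)
        fix g h assume g: "g \<in> H e" "h \<in> H e" and eq: "restrict g ?J = restrict h ?J"
        show "g = h"
        proof
          fix j
          show "g j = h j"
            using g fun_cong[OF eq, of j] True
            by (cases "j \<in> ?J"; cases "j \<in> J") (auto simp: H_def e PiE_iff extensional_def)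
        qed
      qed
      moreover have "(\<lambda>g. restrict g ?J) ` H e \<subseteq> Pi\<^sub>E ?J A"
        unfolding image_subset_iff restrict_PiE_iff by (auto simp: H_def e)
      moreover have "finite (Pi\<^sub>E ?J A)" using assms(2) finA by (intro finite_PiE) auto
      ultimately have "card (H e) \<le> card (Pi\<^sub>E ?J A)" by (metis card_inj_on_le)
      also have "\<dots> = (\<Prod>j\<in>?J. card (A j))" using assms(2) by (simp add: card_PiE)
      also have "\<dots> \<le> (\<Prod>j\<in>?J. card V)" using finA by (intro prod_mono) auto
      also have "\<dots> = card V ^ (card J - 2)"
        using True fuv assms(2) by (simp add: card_Diff_subset numeral_2_eq_2)
      finally show ?thesis .
    next
      case False
      then have "H e = {}" by (auto simp: H_def e)
      then show ?thesis by simp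
    qed
  qed
  have finH: "finite (H e)" for e
    by (rule finite_subset[OF _ finP]) (auto simp: H_def split: prod.splits)
  have "(\<Prod>j\<in>J. card (A j)) = card (Pi\<^sub>E J A)" using assms(2) by (simp add: card_PiE)
  also have "\<dots> \<le> card (?T \<union> (\<Union>e\<in>missing V E f. H e))"
    using finP finH assms(1) by (intro card_mono[OF _ sub]) auto
  also have "\<dots> \<le> card ?T + card (\<Union>e\<in>missing V E f. H e)" by (rule card_Un_le)
  also have "card (\<Union>e\<in>missing V E f. H e) \<le> (\<Sum>e\<in>missing V E f. card (H e))"
    using assms(1) by (intro card_UN_le) auto
  also have "\<dots> \<le> card (missing V E f) * card V ^ (card J - 2)"
    using sum_bounded_above[of "missing V E f" "\<lambda>e. card (H e)"] bd by simp
  finally show ?thesis by simp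
qed

definition transversal_ext ::
    "'a set \<Rightarrow> 'a set set \<Rightarrow> ('a \<Rightarrow> nat) \<Rightarrow> 'a set \<Rightarrow> nat set \<Rightarrow> 'a set set" where
  "transversal_ext V E f W\<^sub>0 J = {W. W\<^sub>0 \<subseteq> W \<and> W \<subseteq> V \<and> clique W E \<and> bij_betw f (W - W\<^sub>0) J}"

lemma finite_transversal_ext [simp]: "finite V \<Longrightarrow> finite (transversal_ext V E f W J)"
  by (rule finite_subset[of _ "Pow V"]) (auto simp: transversal_ext_def)

text \<open>Restricting every class to the common neighbours of \<open>W\<close> turns transversal
  cliques into extensions of \<open>W\<close>. The colouring recovers the choice function from its
  image, so nothing is counted twice.\<close>

lemma card_transversal_ext:
  fixes V :: "'a set"
  assumes "finite V" "E \<subseteq> [V]\<^bsup>2\<^esup>" "finite J" "W \<subseteq> V" "clique W E"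
  shows "(\<Prod>j\<in>J. card {v\<in>V. f v = j \<and> (\<forall>w\<in>W. {w, v} \<in> E)}) \<le>
    card (transversal_ext V E f W J) + card (missing V E f) * card V ^ (card J - 2)"
proof -
  define A where "A j = {v\<in>V. f v = j \<and> (\<forall>w\<in>W. {w, v} \<in> E)}" for j
  define T where "T = {g \<in> Pi\<^sub>E J A. \<forall>i\<in>J. \<forall>j\<in>J. i \<noteq> j \<longrightarrow> {g i, g j} \<in> E}"
  have gA: "g j \<in> V" "f (g j) = j" "\<And>w. w \<in> W \<Longrightarrow> {w, g j} \<in> E" "g j \<notin> W"
    if "g \<in> T" "j \<in> J" for g j
  proof -
    have a: "g j \<in> A j" using that by (auto simp: T_def)
    then show "g j \<in> V" "f (g j) = j" "\<And>w. w \<in> W \<Longrightarrow> {w, g j} \<in> E" by (auto simp: A_def)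
    show "g j \<notin> W" using a edgeD(1)[OF assms(2)] by (auto simp: A_def)
  qed
  have diff: "(W \<union> g ` J) - W = g ` J" if "g \<in> T" for g using gA(4)[OF that] by auto
  have inj: "inj_on (\<lambda>g. W \<union> g ` J) T"
  proof (rule inj_onI)
    fix g h assume g: "g \<in> T" "h \<in> T" and "W \<union> g ` J = W \<union> h ` J"
    then have im: "g ` J = h ` J" using diff by metis
    have "g j = h j" if j: "j \<in> J" for j
    proof -
      obtain i where "i \<in> J" "g j = h i" using im j by blast
      then show ?thesis using gA(2)[OF g(1) j] gA(2)[OF g(2)] by metis
    qed
    then show "g = h" using g by (intro PiE_ext[of g J A h]) (auto simp: T_def)
  qed
  have sub: "(\<lambda>g. W \<union> g ` J) ` T \<subseteq> transversal_ext V E f W J"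
  proof
    fix X assume "X \<in> (\<lambda>g. W \<union> g ` J) ` T"
    then obtain g where g: "g \<in> T" "X = W \<union> g ` J" by auto
    have adj: "{g i, g j} \<in> E" if "i \<in> J" "j \<in> J" "i \<noteq> j" for i j
      using g(1) that by (auto simp: T_def)
    have "clique X E"
      using assms(5) gA(3)[OF g(1)] adj unfolding g(2) clique_def
      by (auto simp: insert_commute) (metis)
    moreover have "bij_betw f (X - W) J"
      using gA(2)[OF g(1)] unfolding g(2) diff[OF g(1)]
      by (auto simp: bij_betw_def inj_on_def image_image)
    ultimately show "X \<in> transversal_ext V E f W J"
      using assms(4) gA(1)[OF g(1)] g(2) by (auto simp: transversal_ext_def)
  qed
  have "card T \<le> card (transversal_ext V E f W J)"
    using card_inj_on_le[OF inj sub] assms(1) by simp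
  moreover have "(\<Prod>j\<in>J. card (A j)) \<le> card T + card (missing V E f) * card V ^ (card J - 2)"
    unfolding T_def by (rule card_transversals) (use assms in \<open>auto simp: A_def\<close>)
  ultimately show ?thesis by (simp add: A_def)
qed

lemma transversal_ext_subset:
  assumes "finite V" "finite J" "W \<subseteq> V"
  shows "transversal_ext V E f W J \<subseteq> clique_copies (card W + card J) \<lparr>verts = V, edges = E\<rparr>"
proof
  fix X assume X: "X \<in> transversal_ext V E f W J"
  then have "card (X - W) = card J" "X = W \<union> (X - W)" "finite X"
    using bij_betw_same_card finite_subset[OF _ assms(1)] by (auto simp: transversal_ext_def)
  then have "card X = card W + card J"
    using card_Un_disjoint[of W "X - W"] finite_subset[OF assms(3,1)] by auto
  then show "X \<in> clique_copies (card W + card J) \<lparr>verts = V, edges = E\<rparr>"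
    using X \<open>finite X\<close> by (auto simp: clique_copies_def nsets_def transversal_ext_def)
qed

text \<open>In such an extension \<open>e\<close> is the only monochromatic pair, so it can be read
  off from the clique. The extensions of different monochromatic edges may therefore be added
  up.\<close>

lemma transversal_ext_disjoint:
  assumes "E \<subseteq> [V]\<^bsup>2\<^esup>" "e \<in> mono_edges E f" "e' \<in> mono_edges E f" "e \<noteq> e'"
  shows "transversal_ext V E f e ({..<p} - f ` e) \<inter> transversal_ext V E f e' ({..<p} - f ` e') = {}"
proof (rule ccontr)
  assume "\<not> ?thesis"
  then obtain W where W: "e' \<subseteq> W" "bij_betw f (W - e) ({..<p} - f ` e)"
    by (auto simp: transversal_ext_def)
  have "e \<in> E" "e' \<in> E" using assms(2,3) mono_edges_subset by blast+
  then obtain x y where e: "e = {x, y}" using assms(1) by (blast elim: edgeE)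
  obtain x' y' where e': "e' = {x', y'}" "x' \<noteq> y'"
    using assms(1) \<open>e' \<in> E\<close> by (blast elim: edgeE)
  have c: "f x = f y" "f x' = f y'" using assms(2,3) e e' by auto
  have out: "f v \<noteq> f x" if "v \<in> W - e" for v
    using W(2) that by (auto simp: bij_betw_def e)
  have "x' \<in> e \<longleftrightarrow> y' \<in> e"
    using out c W(1) e e' by (metis Diff_iff insert_iff singletonD subsetD)
  moreover have "\<not> (x' \<notin> e \<and> y' \<notin> e)"
    using W c e' by (auto simp: bij_betw_def inj_on_def)
  ultimately have "e' = e" using e e' by auto
  with assms(4) show False by simp
qed

lemma sum_ext_le_N_cliques:
  assumes "finite V" "E \<subseteq> [V]\<^bsup>2\<^esup>" "f \<in> V \<rightarrow> {..<p}" "F \<subseteq> mono_edges E f"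
  shows "(\<Sum>e\<in>F. card (transversal_ext V E f e ({..<p} - f ` e)))
    \<le> N_cliques (Suc p) \<lparr>verts = V, edges = E\<rparr>"
proof -
  have finF: "finite F"
    using finite_edges[OF assms(1,2)] assms(4) mono_edges_subset finite_subset by metis
  have "transversal_ext V E f e ({..<p} - f ` e) \<subseteq> clique_copies (Suc p) \<lparr>verts = V, edges = E\<rparr>"
    if "e \<in> F" for e
  proof -
    have eE: "e \<in> E" "e \<in> mono_edges E f" using assms(4) that mono_edges_subset by blast+
    then obtain x y where e: "e = {x, y}" "x \<noteq> y" "x \<in> V" "y \<in> V"
      using assms(2) by (blast elim: edgeE)
    have "f x = f y" using eE e by simp
    have "f x < p" using assms(3) e(3) by auto
    then have "card e + card ({..<p} - f ` e) = Suc p" using e \<open>f x = f y\<close> by simp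
    then show ?thesis using transversal_ext_subset[of V "{..<p} - f ` e" e E f] assms(1) e by auto
  qed
  then have "card (\<Union>e\<in>F. transversal_ext V E f e ({..<p} - f ` e))
      \<le> N_cliques (Suc p) \<lparr>verts = V, edges = E\<rparr>"
    unfolding N_cliques_def
    by (intro card_mono) (auto simp: clique_copies_def assms finite_imp_finite_nsets)
  moreover have "card (\<Union>e\<in>F. transversal_ext V E f e ({..<p} - f ` e)) =
      (\<Sum>e\<in>F. card (transversal_ext V E f e ({..<p} - f ` e)))"
    using finF assms(1,2,4) by (intro card_UN_disjoint ballI impI transversal_ext_disjoint) auto
  ultimately show ?thesis by simp
qed

section \<open>Counting edges of a coloured graph\<close>

lemma multipartite_edge_iff:
  "{x, y} \<in> edges (complete_multipartite p c) \<longleftrightarrow>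
    x \<in> verts (complete_multipartite p c) \<and> y \<in> verts (complete_multipartite p c) \<and> fst x \<noteq> fst y"
  (is "?l \<longleftrightarrow> ?r")
proof
  assume ?l
  then obtain a b where "{x, y} = {a, b}" "a \<in> verts (complete_multipartite p c)"
    "b \<in> verts (complete_multipartite p c)" "fst a \<noteq> fst b"
    unfolding complete_multipartite_def Let_def by auto
  then show ?r by (auto simp: doubleton_eq_iff)
next
  assume ?r
  then show ?l unfolding complete_multipartite_def Let_def by force
qed

lemma verts_multipartite: "verts (complete_multipartite p c) = (SIGMA i:{..<p}. {..<c i})"
  by (simp add: complete_multipartite_def)

lemma two_card_edges_multipartite:
  "2 * card (edges (complete_multipartite p c)) + (\<Sum>j<p. (c j)\<^sup>2) = (\<Sum>j<p. c j)\<^sup>2"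
proof -
  let ?V = "SIGMA i:{..<p}. {..<c i}"
  let ?E = "edges (complete_multipartite p c)"
  have E: "?E \<subseteq> [?V]\<^bsup>2\<^esup>"
    by (auto simp: complete_multipartite_def nsets_def card_2_iff)
  have "arcs ?E = cross ?V fst"
    unfolding arcs_def cross_def multipartite_edge_iff verts_multipartite by auto
  moreover have "card {v \<in> ?V. fst v = j} = c j" if "j < p" for j
  proof -
    have "{v \<in> ?V. fst v = j} = {j} \<times> {..<c j}" using that by auto
    then show ?thesis by simp
  qed
  then have "(\<Sum>j<p. (card {v \<in> ?V. fst v = j})\<^sup>2) = (\<Sum>j<p. (c j)\<^sup>2)" by simp
  moreover have "fst \<in> ?V \<rightarrow> {..<p}" by auto
  moreover have "card ?V = (\<Sum>j<p. c j)" by simp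
  ultimately show ?thesis
    using card_cross[of ?V fst p] card_arcs[OF _ E] by simp
qed

text \<open>The last term is the sum of the squared deviations of the Turan part sizes from
  \<open>n / p\<close>. Up to a factor \<open>p\<close> it is the remainder term inside
  \<open>R\<close>.\<close>

lemma turan_number_eq:
  assumes "p > 0"
  shows "2 * real (turan_number p n) =
    (real n)\<^sup>2 - (real n)\<^sup>2 / p - (real p - real (n mod p)) * real (n mod p) / p"
proof -
  define q r where "q = n div p" and "r = n mod p"
  define c where "c i = q + (if i < r then 1 else 0)" for i
  have n: "n = p * q + r" by (simp add: q_def r_def)
  have "r < p" using assms by (simp add: r_def)
  then have rp: "{..<p} \<inter> {i. i < r} = {..<r}" by auto
  have s1: "(\<Sum>j<p. c j) = n"
    using rp by (simp add: c_def sum.distrib sum.If_cases n)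
  have "(c j)\<^sup>2 = q\<^sup>2 + (if j < r then 2 * q + 1 else 0)" for j
    by (simp add: c_def power2_eq_square algebra_simps)
  then have s2: "(\<Sum>j<p. (c j)\<^sup>2) = p * q\<^sup>2 + r * (2 * q + 1)"
    using rp by (simp add: sum.distrib sum.If_cases)
  have "c = (\<lambda>i. n div p + (if i < n mod p then 1 else 0))"
    by (simp add: c_def q_def r_def fun_eq_iff)
  then have "turan_number p n = card (edges (complete_multipartite p c))"
    by (simp only: turan_number_def turan_graph_def)
  then have "2 * turan_number p n + (p * q\<^sup>2 + r * (2 * q + 1)) = n\<^sup>2"
    using two_card_edges_multipartite[of p c] s1 s2 by simp
  then have "2 * real (turan_number p n) = (real n)\<^sup>2 - (real p * (real q)\<^sup>2 + real r * (2 * real q + 1))"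
    by (simp add: algebra_simps flip: of_nat_eq_iff[where 'a=real])
  moreover have "real p * (real q)\<^sup>2 + real r * (2 * real q + 1) =
      (real n)\<^sup>2 / p + (real p - real r) * real r / p"
    using assms by (simp add: n field_simps power2_eq_square)
  ultimately show ?thesis by (simp add: r_def)
qed

text \<open>Centring at the real average makes the deviations sum to zero, so that no linear term
  survives in the sums of squares.\<close>

definition dev :: "'a set \<Rightarrow> ('a \<Rightarrow> nat) \<Rightarrow> nat \<Rightarrow> nat \<Rightarrow> real" where
  "dev V f p j = real (card {v\<in>V. f v = j}) - real (card V) / real p"

lemma sum_dev:
  assumes "finite V" "f \<in> V \<rightarrow> {..<p}" "p > 0"
  shows "(\<Sum>j<p. dev V f p j) = 0"
proof -
  have "(\<Sum>j<p. real (card {v\<in>V. f v = j})) = real (card V)"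
    using arg_cong[OF sum_card_parts[OF assms(1,2)], of real] by simp
  then show ?thesis using assms(3) by (simp add: dev_def sum_subtractf)
qed

lemma sum_dev_square:
  assumes "finite V" "f \<in> V \<rightarrow> {..<p}" "p > 0"
  shows "(\<Sum>j<p. (dev V f p j)\<^sup>2) =
    (\<Sum>j<p. (real (card {v\<in>V. f v = j}))\<^sup>2) - (real (card V))\<^sup>2 / p"
proof -
  define a where "a = real (card V) / real p"
  define c where "c j = real (card {v\<in>V. f v = j})" for j
  have sc: "(\<Sum>j<p. c j) = real (card V)"
    using arg_cong[OF sum_card_parts[OF assms(1,2)], of real] by (simp add: c_def)
  have "(\<Sum>j<p. (dev V f p j)\<^sup>2) = (\<Sum>j<p. (c j)\<^sup>2 - 2 * a * c j + a\<^sup>2)"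
    by (simp add: dev_def a_def c_def power2_diff algebra_simps)
  also have "\<dots> = (\<Sum>j<p. (c j)\<^sup>2) - 2 * a * real (card V) + p * a\<^sup>2"
    by (simp add: sum.distrib sum_subtractf flip: sum_distrib_left sc)
  also have "\<dots> = (\<Sum>j<p. (c j)\<^sup>2) - (real (card V))\<^sup>2 / p"
    using assms(3) by (simp add: a_def power2_eq_square field_simps)
  finally show ?thesis by (simp add: c_def)
qed

lemma card_cross_dev:
  assumes "finite V" "f \<in> V \<rightarrow> {..<p}" "p > 0"
  shows "real (card (cross V f)) =
    (real (card V))\<^sup>2 - (real (card V))\<^sup>2 / p - (\<Sum>j<p. (dev V f p j)\<^sup>2)"
proof -
  have "real (card (cross V f)) + (\<Sum>j<p. (real (card {v\<in>V. f v = j}))\<^sup>2) = (real (card V))\<^sup>2"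
    using arg_cong[OF card_cross[OF assms(1,2)], of real] by simp
  then show ?thesis using sum_dev_square[OF assms] by linarith
qed

text \<open>The monochromatic edges have to make up for the surplus \<open>t\<close> over the Turan
  number, for the missing pairs and for the imbalance of the classes beyond that of the Turan graph.
  All later structure is extracted from this balance.\<close>

lemma mono_edges_count:
  assumes "finite V" "E \<subseteq> [V]\<^bsup>2\<^esup>" "f \<in> V \<rightarrow> {..<p}" "p > 0" "card V = n"
    "card E = turan_number p n + t"
  shows "2 * real (card (mono_edges E f)) =
    2 * real t + real (card (missing V E f)) + (\<Sum>j<p. (dev V f p j)\<^sup>2)
      - (real p - real (n mod p)) * real (n mod p) / p"
proof -
  have m: "mono_edges E f \<subseteq> [V]\<^bsup>2\<^esup>" using assms(2) mono_edges_subset by blast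
  have "real (2 * card E) + real (card (missing V E f)) =
      real (card (cross V f)) + real (2 * card (mono_edges E f))"
    using card_arcs_missing[OF assms(1,2), of f]
    unfolding card_arcs[OF assms(1,2)] card_arcs[OF assms(1) m] of_nat_add[symmetric] by simp
  then show ?thesis
    using card_cross_dev[OF assms(1,3,4)] turan_number_eq[OF assms(4), of n] assms(5,6) by simp
qed

lemma remainder_term_bounds:
  assumes "p > 0"
  shows "0 \<le> (real p - real (n mod p)) * real (n mod p) / p"
    "(real p - real (n mod p)) * real (n mod p) / p \<le> p"
proof -
  have r: "real (n mod p) \<le> p" using assms by (simp add: less_imp_le)
  then show "0 \<le> (real p - real (n mod p)) * real (n mod p) / p" by simp
  have "(real p - real (n mod p)) * real (n mod p) \<le> real p * real p"
    using r by (intro mult_mono) auto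
  then show "(real p - real (n mod p)) * real (n mod p) / p \<le> p"
    using assms by (simp add: divide_le_eq)
qed

section \<open>First-order expansion of products with a uniform error\<close>

text \<open>The constant depends only on the number of factors and on \<open>C\<close>, which is
  what allows one threshold for all graphs. A further factor multiplies the old error by at most
  \<open>1 + C\<close> and adds the second-order product of \<open>y i\<close> with the sum of the
  others.\<close>

lemma prod_one_plus_approx:
  assumes "0 \<le> (C::real)"
  shows "\<exists>K\<ge>0. \<forall>J (y::nat\<Rightarrow>real) (z::real). finite J \<and> card J = q \<and> (\<forall>j\<in>J. \<bar>y j\<bar> \<le> C) \<and> 0 \<le> z \<and> z \<le> 1
    \<longrightarrow> \<bar>(\<Prod>j\<in>J. 1 + y j * z) - 1 - z * (\<Sum>j\<in>J. y j)\<bar> \<le> K * z\<^sup>2"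
proof (induction q)
  case 0
  then show ?case by (intro exI[of _ 0]) auto
next
  case (Suc q)
  then obtain K where K: "K \<ge> 0" "\<And>J y (z::real). finite J \<and> card J = q \<and> (\<forall>j\<in>J. \<bar>y j\<bar> \<le> C) \<and> 0 \<le> z \<and> z \<le> 1
    \<Longrightarrow> \<bar>(\<Prod>j\<in>(J::nat set). 1 + y j * z) - 1 - z * (\<Sum>j\<in>J. y j)\<bar> \<le> K * z\<^sup>2" by blast
  show ?case
  proof (rule exI[of _ "K * (1 + C) + C * (q * C)"], intro conjI allI impI)
    show "0 \<le> K * (1 + C) + C * (q * C)" using K(1) assms by simp
    fix J and y :: "nat \<Rightarrow> real" and z :: real
    assume h: "finite J \<and> card J = Suc q \<and> (\<forall>j\<in>J. \<bar>y j\<bar> \<le> C) \<and> 0 \<le> z \<and> z \<le> 1"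
    then obtain i I where J: "J = insert i I" "i \<notin> I" "card I = q" "finite I"
      by (metis card_Suc_eq finite_insert)
    define P S where "P = (\<Prod>j\<in>I. 1 + y j * z)" and "S = (\<Sum>j\<in>I. y j)"
    have e: "\<bar>P - 1 - z * S\<bar> \<le> K * z\<^sup>2" using K(2)[of I y z] h J by (auto simp: P_def S_def)
    have yi: "\<bar>y i\<bar> \<le> C" using h J by auto
    have S: "\<bar>S\<bar> \<le> q * C" unfolding S_def
      using order_trans[OF sum_abs[of y I] sum_bounded_above[of I "\<lambda>j. \<bar>y j\<bar>" C]] h J by auto
    have "(\<Prod>j\<in>J. 1 + y j * z) - 1 - z * (\<Sum>j\<in>J. y j) = (P - 1 - z * S) * (1 + y i * z) + y i * S * z\<^sup>2"
      using J by (simp add: P_def S_def algebra_simps power2_eq_square)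
    also have "\<bar>\<dots>\<bar> \<le> \<bar>P - 1 - z * S\<bar> * \<bar>1 + y i * z\<bar> + \<bar>y i\<bar> * \<bar>S\<bar> * z\<^sup>2"
      by (metis (no_types, opaque_lifting) abs_mult abs_power2 abs_triangle_ineq)
    also have "\<dots> \<le> (K * z\<^sup>2) * (1 + C) + C * (q * C) * z\<^sup>2"
    proof (intro add_mono mult_mono e yi S mult_right_mono)
      have "\<bar>y i * z\<bar> \<le> C * 1" unfolding abs_mult using yi h by (intro mult_mono) auto
      then show "\<bar>1 + y i * z\<bar> \<le> 1 + C" by linarith
    qed (use K(1) assms in auto)
    finally show "\<bar>(\<Prod>j\<in>J. 1 + y j * z) - 1 - z * (\<Sum>j\<in>J. y j)\<bar> \<le> (K * (1 + C) + C * (q * C)) * z\<^sup>2"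
      by (simp add: algebra_simps)
  qed
qed

text \<open>This is the preceding expansion at \<open>z = 1 / x\<close>, scaled by
  \<open>x ^ (u + 2)\<close>.\<close>

lemma prod_plus_approx:
  assumes "0 \<le> (C::real)"
  obtains K where "K \<ge> 0" "\<And>J (y::nat\<Rightarrow>real) x. finite J \<Longrightarrow> card J = u + 2 \<Longrightarrow> (\<And>j. j \<in> J \<Longrightarrow> \<bar>y j\<bar> \<le> C) \<Longrightarrow>
    x \<ge> 1 \<Longrightarrow> \<bar>(\<Prod>j\<in>J. x + y j) - x ^ (u + 2) - x ^ (u + 1) * (\<Sum>j\<in>J. y j)\<bar> \<le> K * x ^ u"
proof -
  obtain K where K: "K \<ge> 0" "\<And>J y (z::real). finite J \<and> card J = u + 2 \<and> (\<forall>j\<in>J. \<bar>y j\<bar> \<le> C) \<and> 0 \<le> z \<and> z \<le> 1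
    \<Longrightarrow> \<bar>(\<Prod>j\<in>(J::nat set). 1 + y j * z) - 1 - z * (\<Sum>j\<in>J. y j)\<bar> \<le> K * z\<^sup>2"
    using prod_one_plus_approx[OF assms, of "u + 2"] by blast
  show thesis
  proof (rule that[OF K(1)])
    fix J and y :: "nat \<Rightarrow> real" and x
    assume h: "finite J" "card J = u + 2" "\<And>j. j \<in> J \<Longrightarrow> \<bar>y j\<bar> \<le> C" "x \<ge> (1::real)"
    define P S where "P = (\<Prod>j\<in>J. 1 + y j * (1/x))" and "S = (\<Sum>j\<in>J. y j)"
    have "\<bar>P - 1 - (1/x) * S\<bar> \<le> K * (1/x)\<^sup>2"
      unfolding P_def S_def using h by (intro K(2)) auto
    then have a1: "x ^ (u + 2) * \<bar>P - 1 - (1/x) * S\<bar> \<le> x ^ (u + 2) * (K * (1/x)\<^sup>2)"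
      using h(4) by (intro mult_left_mono) auto
    have a2: "x ^ (u + 2) * (K * (1/x)\<^sup>2) = K * x ^ u"
      using h(4) by (simp add: power_add power2_eq_square)
    have a3: "x ^ (u + 2) * \<bar>P - 1 - (1/x) * S\<bar> = \<bar>x ^ (u + 2) * P - x ^ (u + 2) - x ^ (u + 1) * S\<bar>"
    proof -
      have "x ^ (u + 2) * \<bar>P - 1 - (1/x) * S\<bar> = \<bar>x ^ (u + 2) * (P - 1 - (1/x) * S)\<bar>"
        using h(4) by (simp add: abs_mult)
      also have "x ^ (u + 2) * (P - 1 - (1/x) * S) = x ^ (u + 2) * P - x ^ (u + 2) - x ^ (u + 1) * S"
        using h(4) by (simp add: algebra_simps)
      finally show ?thesis .
    qed
    have a4: "x ^ (u + 2) * P = (\<Prod>j\<in>J. x + y j)"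
    proof -
      have "x ^ (u + 2) * P = (\<Prod>j\<in>J. x) * P" using h by simp
      also have "\<dots> = (\<Prod>j\<in>J. x * (1 + y j * (1/x)))" by (simp only: P_def prod.distrib)
      also have "\<dots> = (\<Prod>j\<in>J. x + y j)" using h(4) by (intro prod.cong) (auto simp: field_simps)
      finally show ?thesis .
    qed
    show "\<bar>(\<Prod>j\<in>J. x + y j) - x ^ (u + 2) - x ^ (u + 1) * (\<Sum>j\<in>J. y j)\<bar> \<le> K * x ^ u"
      using a1 unfolding a2 a3 a4 unfolding S_def .
  qed
qed

section \<open>Covers, and colourings with few monochromatic edges\<close>

text \<open>The minimum is attained because the whole vertex set is a cover; \<open>k > 0\<close>
  rules out the empty clique, which no set meets.\<close>

lemma tau_cover:
  assumes "simple_graph G" "k > 0"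
  obtains S where "S \<subseteq> verts G" "card S = \<tau> k G" "\<And>W. W \<in> clique_copies k G \<Longrightarrow> S \<inter> W \<noteq> {}"
proof -
  let ?P = "\<lambda>m. \<exists>S. S \<subseteq> verts G \<and> card S = m \<and> (\<forall>W\<in>clique_copies k G. S \<inter> W \<noteq> {})"
  have "W \<inter> verts G \<noteq> {}" if "W \<in> clique_copies k G" for W
    using that assms(2) by (auto simp: clique_copies_def nsets_def Int_absorb2)
  then have "?P (card (verts G))" by blast
  then have "?P (\<tau> k G)" unfolding \<tau>_def by (rule LeastI)
  then show thesis using that by blast
qed

lemma tau_le:
  assumes "S \<subseteq> verts G" "\<And>W. W \<in> clique_copies k G \<Longrightarrow> S \<inter> W \<noteq> {}"
  shows "\<tau> k G \<le> card S"
  unfolding \<tau>_def using assms by (intro Least_le) blast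

text \<open>By pigeonhole a clique on \<open>p + 1\<close> vertices repeats a colour and so contains
  a monochromatic edge.\<close>

lemma tau_le_cover_mono:
  assumes "finite V" "f \<in> V \<rightarrow> {..<p}" "S \<subseteq> V"
    and S: "\<And>e. e \<in> mono_edges E f \<Longrightarrow> S \<inter> e \<noteq> {}"
  shows "\<tau> (Suc p) \<lparr>verts = V, edges = E\<rparr> \<le> card S"
proof (rule tau_le)
  fix W assume "W \<in> clique_copies (Suc p) \<lparr>verts = V, edges = E\<rparr>"
  then have W: "W \<subseteq> V" "card W = Suc p" "finite W" "clique W E"
    by (auto simp: clique_copies_def nsets_def)
  have "card (f ` W) \<le> p" using assms(2) W(1) card_mono[of "{..<p}" "f ` W"] by auto
  then have "\<not> inj_on f W" using W(2) card_image by force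
  then obtain x y where "x \<in> W" "y \<in> W" "x \<noteq> y" "f x = f y" by (auto simp: inj_on_def)
  then show "S \<inter> W \<noteq> {}" using W(4) S[of "{x, y}"] by (auto simp: clique_def)
qed (use assms in auto)

text \<open>Moving \<open>x\<close> to colour \<open>j\<close> trades its monochromatic edges for
  its edges into class \<open>j\<close>, which cannot pay off if \<open>f\<close> has the fewest
  monochromatic edges.\<close>

lemma max_cut_degree:
  assumes "finite V" "E \<subseteq> [V]\<^bsup>2\<^esup>" "f \<in> V \<rightarrow> {..<p}"
    and min: "\<And>g. g \<in> V \<rightarrow> {..<p} \<Longrightarrow> card (mono_edges E f) \<le> card (mono_edges E g)"
    and "x \<in> V" "j < p"
  shows "card {y. {x, y} \<in> E \<and> f y = f x} \<le> card {y. {x, y} \<in> E \<and> f y = j}"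
proof -
  define g where "g = f(x := j)"
  define M where "M = {e \<in> mono_edges E f. x \<notin> e}"
  define N where "N i = {y. {x, y} \<in> E \<and> f y = i}" for i
  have xx: "{x, x} \<notin> E" using edgeD(1)[OF assms(2)] by blast
  have N: "finite (N i)" "x \<notin> N i" for i
    using finite_subset[of "N i" V] edgeD(3)[OF assms(2)] assms(1) xx by (auto simp: N_def)
  \<comment> \<open>Stated for any recolouring of \<open>x\<close> alone, so that it applies to both
    \<open>f\<close> and \<open>g\<close> with the same part \<open>M\<close> away from
    \<open>x\<close>.\<close>
  have split: "mono_edges E h = M \<union> (\<lambda>y. {x, y}) ` N (h x)" if "\<And>y. y \<noteq> x \<Longrightarrow> h y = f y" for h
  proof (intro set_eqI)
    fix e
    show "e \<in> mono_edges E h \<longleftrightarrow> e \<in> M \<union> (\<lambda>y. {x, y}) ` N (h x)"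
    proof (cases "e \<in> E")
      case True
      then obtain a b where e: "e = {a, b}" "a \<noteq> b" using assms(2) by (blast elim: edgeE)
      have eq: "e = {x, y} \<longleftrightarrow> y = b" if "a = x" for y using that e by (auto simp: doubleton_eq_iff)
      have eq': "e = {x, y} \<longleftrightarrow> y = a" if "b = x" for y using that e by (auto simp: doubleton_eq_iff)
      consider "a = x" | "b = x" | "a \<noteq> x" "b \<noteq> x" by blast
      then show ?thesis
      proof cases
        case 1
        then show ?thesis using True e that[of b] unfolding image_iff Un_iff Bex_def eq[OF 1]
          by (auto simp: M_def N_def)
      next
        case 2
        then show ?thesis using True e that[of a] unfolding image_iff Un_iff Bex_def eq'[OF 2]
          by (auto simp: M_def N_def insert_commute)
      next
        case 3
        then show ?thesis using True e that by (auto simp: M_def image_iff)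
      qed
    next
      case False
      then show ?thesis using mono_edges_subset[of E h] mono_edges_subset[of E f]
        by (auto simp: M_def N_def)
    qed
  qed
  have card: "card (M \<union> (\<lambda>y. {x, y}) ` N i) = card M + card (N i)" for i
  proof -
    have "M \<inter> (\<lambda>y. {x, y}) ` N i = {}" by (auto simp: M_def)
    moreover have "finite M"
      using finite_edges[OF assms(1,2)] mono_edges_subset[of E f] finite_subset
      unfolding M_def by (metis (no_types, lifting) mem_Collect_eq subsetI subset_trans)
    moreover have "inj_on (\<lambda>y. {x, y}) (N i)" by (auto simp: inj_on_def doubleton_eq_iff)
    ultimately show ?thesis using N(1) by (simp add: card_Un_disjoint card_image)
  qed
  have "g \<in> V \<rightarrow> {..<p}" using assms(3,6) by (auto simp: g_def)
  from min[OF this] show ?thesis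
    using split[of f] split[of g] card by (simp add: g_def N_def)
qed

lemma sum_missing_degree:
  assumes "finite V"
  shows "(\<Sum>x\<in>V. card {y\<in>V. f y \<noteq> f x \<and> {x, y} \<notin> E}) = card (missing V E f)"
proof -
  have "missing V E f = (SIGMA x:V. {y\<in>V. f y \<noteq> f x \<and> {x, y} \<notin> E})"
    by (auto simp: missing_def cross_def arcs_def)
  then show ?thesis using assms by simp
qed

text \<open>Fueredi's argument colours the graph outside the cover. Restoring \<open>S\<close> adds
  at most \<open>2 * (card S * card V)\<close> arcs, once among all edges and once among the
  monochromatic ones, hence the factor four.\<close>

lemma initial_colouring:
  assumes "finite V" "E \<subseteq> [V]\<^bsup>2\<^esup>" "S \<subseteq> V" "p > 0"
    and S: "\<And>W. W \<subseteq> V \<Longrightarrow> card W = Suc p \<Longrightarrow> clique W E \<Longrightarrow> S \<inter> W \<noteq> {}"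
  shows "\<exists>f \<in> V \<rightarrow> {..<p}. card (arcs E) + card (arcs (mono_edges E f))
    \<le> card (cross V f) + 4 * (card S * card V)"
proof -
  define U where "U = V - S"
  define E' where "E' = {e\<in>E. e \<subseteq> U}"
  have E': "E' \<subseteq> [U]\<^bsup>2\<^esup>" using assms(2) by (auto simp: E'_def nsets_def)
  have "\<not> clique W E'" if "W \<subseteq> U" "card W = Suc p" for W
    using S[of W] that by (auto simp: U_def E'_def clique_def)
  from furedi_stability[OF _ E' this] obtain g where g: "g \<in> U \<rightarrow> {..<p}"
    "card (arcs E') + card (arcs (mono_edges E' g)) \<le> card (cross U g)"
    using assms(1) by (auto simp: U_def)
  \<comment> \<open>The colour \<open>0\<close> on the cover is an arbitrary choice; the error term
    absorbs every edge that meets \<open>S\<close>.\<close>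
  define f where "f v = (if v \<in> U then g v else 0)" for v
  have f: "f \<in> V \<rightarrow> {..<p}" using g(1) assms(4) by (auto simp: f_def)
  have finS: "finite S" using assms(1,3) finite_subset by blast
  have bound: "card (arcs F) \<le> card (arcs F') + 2 * (card S * card V)"
    if "F \<subseteq> [V]\<^bsup>2\<^esup>" "F' \<subseteq> [V]\<^bsup>2\<^esup>" "\<And>e. e \<in> F \<Longrightarrow> e \<subseteq> U \<Longrightarrow> e \<in> F'" for F F'
  proof -
    have "(a, b) \<in> arcs F' \<union> (S \<times> V \<union> V \<times> S)" if "{a, b} \<in> F" for a b
      using that edgeD[OF \<open>F \<subseteq> [V]\<^bsup>2\<^esup>\<close> that] \<open>\<And>e. e \<in> F \<Longrightarrow> e \<subseteq> U \<Longrightarrow> e \<in> F'\<close>[OF that]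
      by (auto simp: arcs_def U_def)
    then have "arcs F \<subseteq> arcs F' \<union> (S \<times> V \<union> V \<times> S)"
      by (auto simp: arcs_def)
    then have "card (arcs F) \<le> card (arcs F' \<union> (S \<times> V \<union> V \<times> S))"
      using finite_arcs[OF assms(1) that(2)] finS assms(1) by (intro card_mono) auto
    also have "\<dots> \<le> card (arcs F') + (card (S \<times> V) + card (V \<times> S))"
      by (meson add_left_mono card_Un_le le_trans)
    finally show ?thesis by (simp add: card_cartesian_product mult.commute)
  qed
  have "card (arcs E) \<le> card (arcs E') + 2 * (card S * card V)"
    by (rule bound) (use assms(2) in \<open>auto simp: E'_def\<close>)
  moreover have "card (arcs (mono_edges E f)) \<le> card (arcs (mono_edges E' g)) + 2 * (card S * card V)"
  proof (rule bound)
    show "e \<in> mono_edges E' g" if "e \<in> mono_edges E f" "e \<subseteq> U" for e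
    proof -
      have "g ` e = f ` e" using that(2) by (intro image_cong) (auto simp: f_def)
      then show ?thesis using that by (auto simp: mono_edges_def E'_def)
    qed
  qed (use assms(2) in \<open>auto simp: mono_edges_def E'_def\<close>)
  moreover have "card (cross U g) \<le> card (cross V f)"
    by (intro card_mono finite_cross assms(1)) (auto simp: cross_def f_def U_def)
  ultimately show ?thesis using g(2) f by (intro bexI[of _ f]) auto
qed

section \<open>Structure of graphs with few cliques\<close>

definition miss_deg :: "'a set \<Rightarrow> 'a set set \<Rightarrow> ('a \<Rightarrow> nat) \<Rightarrow> 'a \<Rightarrow> nat" where
  "miss_deg V E f x = card {y\<in>V. f y \<noteq> f x \<and> {x, y} \<notin> E}"

text \<open>Here \<open>p = k - 1\<close> and \<open>u = k - 4\<close>, so that the exponents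
  \<open>k - 2\<close>, \<open>k - 3\<close> and \<open>k - 4\<close> become \<open>u + 2\<close>,
  \<open>u + 1\<close> and \<open>u\<close>.\<close>

locale coloured_graph =
  fixes V :: "'a set" and E :: "'a set set" and f :: "'a \<Rightarrow> nat" and p u n s t :: nat
  assumes finV: "finite V" and E: "E \<subseteq> [V]\<^bsup>2\<^esup>" and f: "f \<in> V \<rightarrow> {..<p}" and p_eq: "p = u + 3"
    and card_V: "card V = n" and n: "n > 0" and card_E: "card E = turan_number p n + t"
begin

lemma p_pos: "p > 0" "real p > 1" "real p > 0" by (auto simp: p_eq)

lemma p_minus: "p - Suc 0 = u + 2" "p - Suc (Suc (Suc 0)) = u" by (simp_all add: p_eq)

lemma card_colours: "i < p \<Longrightarrow> card ({..<p} - {i}) = u + 2" by (simp add: p_minus)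

abbreviation "B \<equiv> mono_edges E f"
abbreviation "M \<equiv> real (card (missing V E f))"
abbreviation "D \<equiv> (\<Sum>j<p. (dev V f p j)\<^sup>2)"
abbreviation "N \<equiv> real (N_cliques (p + 1) \<lparr>verts = V, edges = E\<rparr>)"
abbreviation "md \<equiv> miss_deg V E f"
abbreviation "ext e \<equiv> transversal_ext V E f e ({..<p} - f ` e)"

lemma finB: "finite B"
  using finite_edges[OF finV E] mono_edges_subset finite_subset by metis

lemma B_E:
  assumes "e \<in> B"
  obtains x y where "e = {x, y}" "x \<noteq> y" "x \<in> V" "y \<in> V" "f x = f y" "f x < p" "{x, y} \<in> E"
proof -
  have "e \<in> E" using assms mono_edges_subset by blast
  then obtain x y where e: "e = {x, y}" "x \<noteq> y" "x \<in> V" "y \<in> V" using E by (blast elim: edgeE)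
  moreover have "f x < p" using f e(3) by auto
  ultimately show thesis using that assms by simp
qed

lemma count: "2 * real (card B) = 2 * real t + M + D - (real p - real (n mod p)) * real (n mod p) / p"
  by (rule mono_edges_count[OF finV E f p_pos(1) card_V card_E])

lemma D_nonneg: "0 \<le> D" by (intro sum_nonneg) auto

lemma M_D_le: "M + D \<le> 2 * real (card B) + p"
  using count remainder_term_bounds(2)[OF p_pos(1), of n] by simp

lemma sum_md: "(\<Sum>x\<in>V. md x) = card (missing V E f)"
  using sum_missing_degree[OF finV] by (simp add: miss_deg_def)

lemma md_le_M: "x \<in> V \<Longrightarrow> real (md x) \<le> M"
  using member_le_sum[of x V md] finV sum_md by simp

lemma sum_N: "F \<subseteq> B \<Longrightarrow> (\<Sum>e\<in>F. real (card (ext e))) \<le> N"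
  using sum_ext_le_N_cliques[OF finV E f, of F] by (simp flip: of_nat_sum)

lemma dev_square_le: "j < p \<Longrightarrow> (dev V f p j)\<^sup>2 \<le> D"
  by (rule member_le_sum) auto

lemma card_part: "real (card {v\<in>V. f v = j}) = real n / p + dev V f p j"
  by (simp add: dev_def card_V)

lemma abs_dev_le:
  assumes "j < p" shows "\<bar>dev V f p j\<bar> \<le> D + 1"
proof -
  have "\<bar>dev V f p j\<bar> \<le> (dev V f p j)\<^sup>2 + 1"
    using zero_le_power2[of "\<bar>dev V f p j\<bar> - 1/2"] by (simp add: power2_eq_square algebra_simps abs_if split: if_splits)
  then show ?thesis using dev_square_le[OF assms] by linarith
qed

text \<open>A vertex with \<open>\<epsilon> * n\<close> neighbours of its own colour has, by
  minimality, at least as many of every colour. It then lies in about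
  \<open>(\<epsilon> * n) ^ p\<close> transversal cliques, a factor of order \<open>n\<close> above
  the assumed bound on \<open>N\<close>.\<close>

lemma mono_degree_less:
  fixes L \<epsilon> :: real
  assumes min: "\<And>g. g \<in> V \<rightarrow> {..<p} \<Longrightarrow> card B \<le> card (mono_edges E g)"
    and "M \<le> L * n" "N \<le> real s * real n ^ (u + 2)" "\<epsilon> > 0" "\<epsilon> ^ p * n > s + L" "x \<in> V"
  shows "real (card {y. {x, y} \<in> E \<and> f y = f x}) < \<epsilon> * n"
proof (rule ccontr)
  assume "\<not> ?thesis"
  then have big: "\<epsilon> * n \<le> real (card {y. {x, y} \<in> E \<and> f y = f x})" by simp
  let ?A = "\<lambda>j. {v\<in>V. f v = j \<and> (\<forall>w\<in>{x}. {w, v} \<in> E)}"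
  have A: "\<epsilon> * n \<le> real (card (?A j))" if "j < p" for j
  proof -
    have "?A j = {y. {x, y} \<in> E \<and> f y = j}" using edgeD[OF E] by auto
    then show ?thesis using max_cut_degree[OF finV E f min \<open>x \<in> V\<close> that] big by simp
  qed
  have "(\<epsilon> * n) ^ p = (\<Prod>j<p. \<epsilon> * n)" by simp
  also have "\<dots> \<le> (\<Prod>j<p. real (card (?A j)))" using A assms(4) by (intro prod_mono) auto
  also have "\<dots> \<le> real (card (transversal_ext V E f {x} {..<p})) + M * real n ^ (u + 1)"
    using card_transversal_ext[OF finV E, of "{..<p}" "{x}" f] \<open>x \<in> V\<close>
    by (simp add: card_V clique_def p_eq flip: of_nat_prod of_nat_mult of_nat_add of_nat_power)
  also have "real (card (transversal_ext V E f {x} {..<p})) \<le> N"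
    using transversal_ext_subset[OF finV, of "{..<p}" "{x}" E f] \<open>x \<in> V\<close> finV unfolding N_cliques_def
    by (simp add: card_mono clique_copies_def finite_imp_finite_nsets)
  also have "N \<le> real s * real n ^ (u + 2)" by fact
  also have "M * real n ^ (u + 1) \<le> (L * n) * real n ^ (u + 1)"
    using assms(2) by (intro mult_right_mono) auto
  finally have "(\<epsilon> ^ p * n) * real n ^ (u + 2) \<le> (s + L) * real n ^ (u + 2)"
    by (simp add: power_mult_distrib algebra_simps power_add numeral_3_eq_3 p_eq)
  then show False using assms(5) n by (simp add: mult_le_cancel_right)
qed

text \<open>The number \<open>a j\<close> counts the common neighbours of \<open>x\<close> and
  \<open>y\<close> of colour \<open>j\<close>. The last bound is stronger than the sum of the second
  ones: a missing pair at \<open>x\<close> or \<open>y\<close> costs a vertex in only one class, so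
  it is charged once and not once per class. This sharp coefficient decides the first-order
  comparison later.\<close>

lemma ext_lower:
  assumes e: "e = {x, y}" "x \<noteq> y" "x \<in> V" "y \<in> V" "f x = f y" "f x < p" "{x, y} \<in> E"
  obtains a where
    "(\<Prod>j\<in>{..<p} - {f x}. real (a j)) \<le> real (card (ext e)) + M * real n ^ u"
    "\<And>j. j < p \<Longrightarrow> j \<noteq> f x \<Longrightarrow> real (card {v\<in>V. f v = j}) - md x - md y \<le> real (a j)"
    "\<And>j. a j \<le> card {v\<in>V. f v = j}"
    "real n - real (card {v\<in>V. f v = f x}) - md x - md y \<le> (\<Sum>j\<in>{..<p} - {f x}. real (a j))"
proof -
  define A where "A j = {v\<in>V. f v = j \<and> (\<forall>w\<in>e. {w, v} \<in> E)}" for j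
  define Q where "Q w = {v\<in>V. f v \<noteq> f w \<and> {w, v} \<notin> E}" for w
  have finQ: "finite (Q w)" "finite (A j)" for w j using finV by (auto simp: Q_def A_def)
  have "f ` e = {f x}" using e by auto
  then have "(\<Prod>j\<in>{..<p} - {f x}. card (A j)) \<le> card (ext e) + card (missing V E f) * n ^ u"
    using card_transversal_ext[OF finV E, of "{..<p} - {f x}" e f] e
    by (simp add: card_V p_minus clique_def insert_commute A_def)
  then have 1: "(\<Prod>j\<in>{..<p} - {f x}. real (card (A j))) \<le> real (card (ext e)) + M * real n ^ u"
    by (simp flip: of_nat_prod of_nat_mult of_nat_add of_nat_power)
  have 2: "real (card {v\<in>V. f v = j}) - md x - md y \<le> real (card (A j))" if "j \<noteq> f x" for j
  proof -
    have "{v\<in>V. f v = j} \<subseteq> A j \<union> (Q x \<union> Q y)" using e that by (auto simp: A_def Q_def)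
    then have "card {v\<in>V. f v = j} \<le> card (A j \<union> (Q x \<union> Q y))" using finQ by (intro card_mono) auto
    also have "\<dots> \<le> card (A j) + (card (Q x) + card (Q y))"
      by (meson add_left_mono card_Un_le le_trans)
    finally show ?thesis by (simp add: miss_deg_def Q_def)
  qed
  have 3: "card (A j) \<le> card {v\<in>V. f v = j}" for j
    using finV by (intro card_mono) (auto simp: A_def)
  have 4: "real n - real (card {v\<in>V. f v = f x}) - md x - md y \<le> (\<Sum>j\<in>{..<p} - {f x}. real (card (A j)))"
  proof -
    have "V \<subseteq> (\<Union>j\<in>{..<p} - {f x}. A j) \<union> ({v\<in>V. f v = f x} \<union> (Q x \<union> Q y))"
      using e f by (auto simp: A_def Q_def)
    then have "n \<le> card ((\<Union>j\<in>{..<p} - {f x}. A j) \<union> ({v\<in>V. f v = f x} \<union> (Q x \<union> Q y)))"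
      unfolding card_V[symmetric] using finQ finV by (intro card_mono) auto
    also have "\<dots> \<le> card (\<Union>j\<in>{..<p} - {f x}. A j) + (card {v\<in>V. f v = f x} + (card (Q x) + card (Q y)))"
      by (meson add_mono card_Un_le le_trans order_refl)
    also have "card (\<Union>j\<in>{..<p} - {f x}. A j) \<le> (\<Sum>j\<in>{..<p} - {f x}. card (A j))"
      by (intro card_UN_le) auto
    finally have "real n \<le> (\<Sum>j\<in>{..<p} - {f x}. real (card (A j))) + (card {v\<in>V. f v = f x} + (md x + md y))"
      unfolding miss_deg_def Q_def by (simp flip: of_nat_sum of_nat_add)
    then show ?thesis by simp
  qed
  show thesis using that[of "\<lambda>j. card (A j)"] 1 2 3 4 by blast
qed

text \<open>A monochromatic edge that avoids the vertices with many missing pairs lies in at least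
  \<open>\<kappa> * n ^ (u + 2)\<close> copies, which bounds the number of such edges. It remains to
  show that there are no vertices to avoid.\<close>

lemma card_B_le:
  fixes L \<kappa> :: real
  defines "\<kappa> \<equiv> (1 / (2 * real p)) ^ (u + 2) / 2"
  assumes deg: "\<And>x. x \<in> V \<Longrightarrow> real (card {y. {x, y} \<in> E \<and> f y = f x}) < (1 / (32 * real p)) * n"
    and M_le: "M \<le> L * n" and part: "\<And>j. j < p \<Longrightarrow> 3 * real n / (4 * real p) \<le> card {v\<in>V. f v = j}"
    and N_le: "N \<le> real s * real n ^ (u + 2)" and L_le: "L \<le> \<kappa> * n"
    and big: "n / (32 * real p) - p / 2 > s / \<kappa>"
  shows "real (card B) \<le> s / \<kappa>"
proof -
  have kpos: "\<kappa> > 0" using p_pos by (simp add: \<kappa>_def)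
  \<comment> \<open>Losing less than \<open>n / (8 * p)\<close> at each end leaves at least
    \<open>n / (2 * p)\<close> common neighbours in every other class, since classes have at least
    \<open>3 * n / (4 * p)\<close> vertices.\<close>
  define U where "U = {x\<in>V. real n / (8 * real p) \<le> md x}"
  define B' where "B' = {e\<in>B. e \<inter> U = {}}"
  have ext: "\<kappa> * real n ^ (u + 2) \<le> real (card (ext e))" if eB': "e \<in> B'" for e
  proof -
    have "e \<in> B" using eB' by (auto simp: B'_def)
    then obtain x y where e: "e = {x, y}" "x \<noteq> y" "x \<in> V" "y \<in> V" "f x = f y" "f x < p" "{x, y} \<in> E"
      by (rule B_E)
    obtain a where a: "(\<Prod>j\<in>{..<p} - {f x}. real (a j)) \<le> real (card (ext e)) + M * real n ^ u"
      "\<And>j. j < p \<Longrightarrow> j \<noteq> f x \<Longrightarrow> real (card {v\<in>V. f v = j}) - md x - md y \<le> real (a j)"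
      "\<And>j. a j \<le> card {v\<in>V. f v = j}"
      "real n - real (card {v\<in>V. f v = f x}) - md x - md y \<le> (\<Sum>j\<in>{..<p} - {f x}. real (a j))"
      by (rule ext_lower[OF e]) (rule that)
    have "x \<notin> U" "y \<notin> U" using eB' e by (auto simp: B'_def)
    then have m: "md x < real n / (8 * real p)" "md y < real n / (8 * real p)"
      using e by (auto simp: U_def)
    have "n / (2 * real p) \<le> a j" if "j < p" "j \<noteq> f x" for j
    proof -
      have "n / (2 * real p) = 3 * real n / (4 * real p) - real n / (8 * real p) - real n / (8 * real p)"
        using p_pos by (simp add: field_simps)
      then show ?thesis using a(2)[OF that] part[OF that(1)] m by linarith
    qed
    then have "(\<Prod>j\<in>{..<p} - {f x}. n / (2 * real p)) \<le> (\<Prod>j\<in>{..<p} - {f x}. real (a j))"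
      by (intro prod_mono) auto
    moreover have "(\<Prod>j\<in>{..<p} - {f x}. n / (2 * real p)) = 2 * \<kappa> * real n ^ (u + 2)"
      using e(6) by (simp add: \<kappa>_def power_divide power_mult_distrib p_minus)
    \<comment> \<open>The final halving in \<open>\<kappa>\<close> sets aside half of the product
      for the missing pairs.\<close>
    moreover have "M * real n ^ u \<le> \<kappa> * real n ^ (u + 2)"
    proof -
      have "M * real n ^ u \<le> (L * n) * real n ^ u" using M_le by (intro mult_right_mono) auto
      also have "\<dots> \<le> (\<kappa> * n * n) * real n ^ u" using L_le by (intro mult_right_mono) auto
      finally show ?thesis by (simp add: algebra_simps)
    qed
    ultimately show ?thesis using a(1) by linarith
  qed
  have "real (card B') * (\<kappa> * real n ^ (u + 2)) \<le> (\<Sum>e\<in>B'. real (card (ext e)))"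
    using ext by (rule sum_bounded_below)
  also have "\<dots> \<le> N" by (rule sum_N) (auto simp: B'_def)
  also have "\<dots> \<le> real s * real n ^ (u + 2)" by fact
  finally have "(real (card B') * \<kappa>) * real n ^ (u + 2) \<le> real s * real n ^ (u + 2)" by simp
  then have cB': "real (card B') \<le> s / \<kappa>" using kpos n by (simp add: field_simps)
  \<comment> \<open>A vertex of \<open>U\<close> has at least four times as many missing pairs as
    monochromatic edges, whereas the edge balance allows at most about two missing pairs per
    monochromatic edge. One such vertex would already make \<open>B'\<close> too large.\<close>
  have "U = {}"
  proof (rule ccontr)
    assume "U \<noteq> {}"
    have finU: "finite U" using finV by (simp add: U_def)
    with \<open>U \<noteq> {}\<close> have U1: "1 \<le> real (card U)" by (simp add: Suc_leI card_gt_0_iff)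
    have "B \<subseteq> B' \<union> (\<Union>x\<in>U. (\<lambda>y. {x, y}) ` {y. {x, y} \<in> E \<and> f y = f x})"
    proof
      fix e assume eB: "e \<in> B"
      then obtain x y where e: "e = {x, y}" "x \<noteq> y" "x \<in> V" "y \<in> V" "f x = f y" "{x, y} \<in> E"
        by (rule B_E)
      show "e \<in> B' \<union> (\<Union>x\<in>U. (\<lambda>y. {x, y}) ` {y. {x, y} \<in> E \<and> f y = f x})"
      proof (cases "x \<in> U \<or> y \<in> U")
        case True
        then show ?thesis
        proof
          assume "x \<in> U"
          moreover have "e \<in> (\<lambda>z. {x, z}) ` {z. {x, z} \<in> E \<and> f z = f x}"
            using e by auto
          ultimately show ?thesis by blast
        next
          assume "y \<in> U"
          moreover have "e \<in> (\<lambda>z. {y, z}) ` {z. {y, z} \<in> E \<and> f z = f y}"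
            using e by (auto simp: insert_commute)
          ultimately show ?thesis by blast
        qed
      next
        case False
        then show ?thesis using e eB by (auto simp: B'_def)
      qed
    qed
    moreover have finN: "finite {y. {x, y} \<in> E \<and> f y = f x}" for x
      by (rule finite_subset[OF _ finV]) (use edgeD[OF E] in auto)
    ultimately have "card B \<le> card (B' \<union> (\<Union>x\<in>U. (\<lambda>y. {x, y}) ` {y. {x, y} \<in> E \<and> f y = f x}))"
      using finB finU by (intro card_mono) (auto simp: B'_def)
    also have "\<dots> \<le> card B' + card (\<Union>x\<in>U. (\<lambda>y. {x, y}) ` {y. {x, y} \<in> E \<and> f y = f x})"
      by (rule card_Un_le)
    also have "card (\<Union>x\<in>U. (\<lambda>y. {x, y}) ` {y. {x, y} \<in> E \<and> f y = f x})
        \<le> (\<Sum>x\<in>U. card ((\<lambda>y. {x, y}) ` {y. {x, y} \<in> E \<and> f y = f x}))"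
      using finU by (rule card_UN_le)
    also have "\<dots> \<le> (\<Sum>x\<in>U. card {y. {x, y} \<in> E \<and> f y = f x})"
      using finN by (intro sum_mono card_image_le)
    finally have "real (card B) \<le> real (card B') + (\<Sum>x\<in>U. real (card {y. {x, y} \<in> E \<and> f y = f x}))"
      by (simp flip: of_nat_sum of_nat_add)
    also have "(\<Sum>x\<in>U. real (card {y. {x, y} \<in> E \<and> f y = f x})) \<le> card U * ((1 / (32 * real p)) * n)"
      using deg by (intro sum_bounded_above) (auto simp: U_def intro: less_imp_le)
    finally have b1: "real (card B) \<le> real (card B') + card U * (n / (32 * real p))" by simp
    have "card U * (real n / (8 * real p)) \<le> (\<Sum>x\<in>U. real (md x))"
      by (intro sum_bounded_below) (auto simp: U_def)
    also have "\<dots> \<le> (\<Sum>x\<in>V. real (md x))"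
      using finV by (intro sum_mono2) (auto simp: U_def)
    also have "\<dots> = M" using sum_md by (simp flip: of_nat_sum)
    finally have b2: "card U * (real n / (8 * real p)) \<le> M" .
    have b3: "M - p \<le> 2 * real (card B)"
      using count D_nonneg remainder_term_bounds(2)[OF p_pos(1), of n] by simp
    have "card U * (real n / (8 * real p)) = 4 * (card U * (n / (32 * real p)))" by simp
    then have "card U * (n / (32 * real p)) - p / 2 \<le> real (card B')" using b1 b2 b3 by linarith
    moreover have "1 * (n / (32 * real p)) \<le> card U * (n / (32 * real p))"
      using U1 by (intro mult_right_mono) auto
    ultimately show False using big cB' by linarith
  qed
  then have "B' = B" by (auto simp: B'_def)
  then show ?thesis using cB' by simp
qed

end

section \<open>The parameter \<open>R\<close> and the deviations of the class sizes\<close>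

text \<open>The second identity is the origin of \<open>R\<close>: with exactly \<open>s\<close>
  monochromatic edges, \<open>mono_edges_count\<close> gives its right side as the value of
  \<open>M + D\<close>.\<close>

lemma R_props:
  assumes "t < s" "p > 1"
  shows "R (p + 1) n s t > 0"
    "(R (p + 1) n s t)\<^sup>2 * (real p - 1) / p =
      2 * (real s - real t) + (real p - real (n mod p)) * real (n mod p) / p"
proof -
  let ?a = "2 * real p * (real s - real t) + (real p - real (n mod p)) * real (n mod p)"
  have r: "r_rem n (p + 1) = n mod p"
    by (simp add: r_rem_def minus_mult_div_eq_mod)
  have "n mod p < p" using assms by simp
  then have "(real p - real (n mod p)) * real (n mod p) \<ge> 0" by simp
  moreover have "2 * real p * (real s - real t) > 0" using assms by simp
  ultimately have a: "?a > 0" by linarith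
  have R: "R (p + 1) n s t = sqrt (?a / (real p - 1))"
    unfolding R_def r by (simp add: algebra_simps)
  show "R (p + 1) n s t > 0" unfolding R using a assms by simp
  have sq: "(R (p + 1) n s t)\<^sup>2 * (real p - 1) = ?a"
    unfolding R using a assms by simp
  show "(R (p + 1) n s t)\<^sup>2 * (real p - 1) / p =
      2 * (real s - real t) + (real p - real (n mod p)) * real (n mod p) / p"
    unfolding sq using assms by (simp add: add_divide_distrib)
qed

text \<open>Hence \<open>R\<close> takes finitely many values as \<open>n\<close> varies, which
  yields constants uniform in \<open>n\<close>.\<close>

lemma R_mod: "R (p + 1) n s t = R (p + 1) (n mod p) s t"
  by (simp add: R_def r_rem_def minus_mult_div_eq_mod)

lemma n_minus_eq: "n_minus (p + 1) n s t = real n / p - R (p + 1) n s t / p"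
  by (simp add: n_minus_def diff_divide_distrib)

text \<open>The deviations other than \<open>d i\<close> have mean \<open>- d i / (p - 1)\<close>,
  and the left side is their spread about it. Nonnegativity will bound \<open>d i\<close> by the sum
  of squares, and a vanishing spread will make the other classes equal in size.\<close>

lemma sum_zero_square_identity:
  fixes d :: "nat \<Rightarrow> real"
  assumes "(\<Sum>j<p. d j) = 0" "i < p" "p > 1"
  shows "(\<Sum>j\<in>{..<p} - {i}. (d j + d i / (real p - 1))\<^sup>2) =
    (\<Sum>j<p. (d j)\<^sup>2) - p * (d i)\<^sup>2 / (real p - 1)"
proof -
  define J where "J = {..<p} - {i}"
  have s1: "(\<Sum>j\<in>J. d j) = - d i" and s2: "(\<Sum>j\<in>J. (d j)\<^sup>2) = (\<Sum>j<p. (d j)\<^sup>2) - (d i)\<^sup>2"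
    using assms by (simp_all add: J_def sum_diff1)
  have cJ: "real (card J) = real p - 1" using assms by (simp add: J_def of_nat_diff)
  define b where "b = d i / (real p - 1)"
  have b: "(real p - 1) * b = d i" using assms by (simp add: b_def)
  have "(\<Sum>j\<in>J. (d j + b)\<^sup>2) = (\<Sum>j\<in>J. (d j)\<^sup>2 + 2 * b * d j + b\<^sup>2)"
    by (simp add: power2_eq_square algebra_simps)
  also have "\<dots> = (\<Sum>j\<in>J. (d j)\<^sup>2) + 2 * b * (\<Sum>j\<in>J. d j) + real (card J) * b\<^sup>2"
    by (simp add: sum.distrib sum_distrib_left)
  also have "\<dots> = (\<Sum>j<p. (d j)\<^sup>2) - (d i)\<^sup>2 - 2 * b * d i + ((real p - 1) * b) * b"
    unfolding s1 s2 cJ by (simp add: power2_eq_square algebra_simps)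
  also have "\<dots> = (\<Sum>j<p. (d j)\<^sup>2) - ((d i)\<^sup>2 + d i * b)" unfolding b by simp
  also have "(d i)\<^sup>2 + d i * b = p * (d i)\<^sup>2 / (real p - 1)"
    using assms by (simp add: b_def field_simps power2_eq_square)
  finally show ?thesis by (simp add: J_def b_def)
qed

context coloured_graph
begin

abbreviation "col e \<equiv> the_elem (f ` e)"

lemma col_less: "e \<in> B \<Longrightarrow> col e < p"
  by (erule B_E) simp

text \<open>The product of the common neighbourhood sizes is expanded around \<open>n / p\<close>.
  The classes other than that of \<open>e\<close> contain all vertices outside it, so only the
  deviation of this one class enters the first-order term.\<close>

lemma card_ext_ge:
  fixes x :: real
  assumes x: "x = real n / p" and K: "\<forall>J (y::nat\<Rightarrow>real). finite J \<and> card J = u + 2 \<and> (\<forall>j\<in>J. \<bar>y j\<bar> \<le> C) \<longrightarrow>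
      \<bar>(\<Prod>j\<in>J. x + y j) - x ^ (u + 2) - x ^ (u + 1) * (\<Sum>j\<in>J. y j)\<bar> \<le> K * x ^ u"
    and MD: "M + D \<le> C\<^sub>1" and C: "3 * C\<^sub>1 + 1 \<le> C" and "e \<in> B"
  shows "x ^ (u + 2) - x ^ (u + 1) * (dev V f p (col e) + (\<Sum>v\<in>e. real (md v))) - (K + C\<^sub>1 * real p ^ u) * x ^ u
      \<le> real (card (ext e))" (is ?A)
    and "dev V f p (col e) + (\<Sum>v\<in>e. real (md v)) \<le> C" (is ?B)
proof -
  obtain v w where e: "e = {v, w}" "v \<noteq> w" "v \<in> V" "w \<in> V" "f v = f w" "f v < p" "{v, w} \<in> E"
    using \<open>e \<in> B\<close> by (rule B_E)
  have col: "col e = f v" using e by simp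
  obtain a where a: "(\<Prod>j\<in>{..<p} - {f v}. real (a j)) \<le> real (card (ext e)) + M * real n ^ u"
      "\<And>j. j < p \<Longrightarrow> j \<noteq> f v \<Longrightarrow> real (card {z\<in>V. f z = j}) - md v - md w \<le> real (a j)"
      "\<And>j. a j \<le> card {z\<in>V. f z = j}"
      "real n - real (card {z\<in>V. f z = f v}) - md v - md w \<le> (\<Sum>j\<in>{..<p} - {f v}. real (a j))"
      by (rule ext_lower[OF e]) (rule that)
  define J where "J = {..<p} - {f v}"
  have J: "finite J" "card J = u + 2" using card_colours[OF e(6)] by (auto simp: J_def)
  have pu: "real p - 1 = real (u + 2)" by (simp add: p_eq)
  have md: "real (md v) \<le> M" "real (md w) \<le> M" using md_le_M e by auto
  have M0: "M \<ge> 0" by simp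
  \<comment> \<open>A deviation is at most \<open>D + 1\<close> and each missing degree at most
    \<open>M\<close>, which explains the constant \<open>3 * C\<^sub>1 + 1\<close>.\<close>
  have y: "\<bar>real (a j) - x\<bar> \<le> C" if "j \<in> J" for j
  proof -
    have j: "j < p" "j \<noteq> f v" using that by (auto simp: J_def)
    have "real (a j) \<le> x + dev V f p j" using a(3)[of j] card_part[of j] x by simp
    moreover have "x + dev V f p j - md v - md w \<le> real (a j)" using a(2)[OF j] card_part[of j] x by simp
    ultimately show ?thesis using abs_dev_le[OF j(1)] md MD C M0 D_nonneg by linarith
  qed
  have "\<bar>(\<Prod>j\<in>J. x + (real (a j) - x)) - x ^ (u + 2) - x ^ (u + 1) * (\<Sum>j\<in>J. real (a j) - x)\<bar> \<le> K * x ^ u"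
    using K[THEN spec, THEN spec, of J "\<lambda>j. real (a j) - x"] J y by blast
  then have "x ^ (u + 2) + x ^ (u + 1) * (\<Sum>j\<in>J. real (a j) - x) - K * x ^ u \<le> (\<Prod>j\<in>J. real (a j))"
    by (simp add: abs_le_iff)
  moreover have "x ^ (u + 1) * (- (dev V f p (f v) + md v + md w)) \<le> x ^ (u + 1) * (\<Sum>j\<in>J. real (a j) - x)"
  proof (intro mult_left_mono)
    have "(\<Sum>j\<in>J. real (a j) - x) = (\<Sum>j\<in>J. real (a j)) - (real p - 1) * x"
      using J pu by (simp add: sum_subtractf)
    also have "(real p - 1) * x = n - x" using p_pos by (simp add: x field_simps)
    finally show "- (dev V f p (f v) + md v + md w) \<le> (\<Sum>j\<in>J. real (a j) - x)"
      using a(4) card_part[of "f v"] x by (simp add: J_def)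
  qed (simp add: x)
  moreover have "M * real n ^ u \<le> C\<^sub>1 * real p ^ u * x ^ u"
  proof -
    have "real n ^ u = real p ^ u * x ^ u" using p_pos by (simp add: x flip: power_mult_distrib)
    then have "M * real n ^ u = M * (real p ^ u * x ^ u)" by simp
    also have "\<dots> \<le> C\<^sub>1 * (real p ^ u * x ^ u)"
      using MD D_nonneg by (intro mult_right_mono) (auto simp: x)
    finally show ?thesis by (simp add: mult.assoc)
  qed
  ultimately have "x ^ (u + 2) - x ^ (u + 1) * (dev V f p (f v) + md v + md w) - (K + C\<^sub>1 * real p ^ u) * x ^ u
      \<le> real (card (ext e))"
    using a(1) unfolding J_def by (simp add: algebra_simps)
  then show ?A using e by (simp add: algebra_simps)
  show ?B unfolding col using e abs_dev_le[OF e(6)] md MD C M0 D_nonneg by simp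
qed

text \<open>Already \<open>s + 1\<close> monochromatic edges would give
  \<open>(s + 1) * x ^ (u + 2)\<close> copies up to terms of order \<open>x ^ (u + 1)\<close>, which
  exceeds the bound on \<open>N\<close>.\<close>

lemma card_B_le_s:
  fixes x :: real
  assumes x: "x = real n / p" and K: "\<forall>J (y::nat\<Rightarrow>real). finite J \<and> card J = u + 2 \<and> (\<forall>j\<in>J. \<bar>y j\<bar> \<le> C) \<longrightarrow>
      \<bar>(\<Prod>j\<in>J. x + y j) - x ^ (u + 2) - x ^ (u + 1) * (\<Sum>j\<in>J. y j)\<bar> \<le> K * x ^ u"
    and K0: "K \<ge> 0"
    and MD: "M + D \<le> C\<^sub>1" and C: "3 * C\<^sub>1 + 1 \<le> C" and x1: "x \<ge> 1"
    and N_le: "N \<le> real s * x ^ (u + 2)"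
    and big: "x > (real s + 1) * (C + (K + C\<^sub>1 * real p ^ u))"
  shows "card B \<le> s"
proof (rule ccontr)
  assume "\<not> card B \<le> s"
  then obtain F where F: "F \<subseteq> B" "card F = s + 1"
    by (metis Suc_eq_plus1 not_less_eq_eq obtain_subset_with_card_n)
  define K' where "K' = K + C\<^sub>1 * real p ^ u"
  have C10: "C\<^sub>1 \<ge> 0" using MD D_nonneg by (smt (verit) of_nat_0_le_iff)
  then have K'0: "K' \<ge> 0" using K0 by (simp add: K'_def)
  have "x ^ (u + 2) - (C + K') * x ^ (u + 1) \<le> real (card (ext e))" if "e \<in> F" for e
  proof -
    have "e \<in> B" using that F by auto
    note * = card_ext_ge[OF x K MD C this]
    have x0: "0 \<le> x" using order_trans[OF zero_le_one x1] .
    have "x ^ (u + 1) * (dev V f p (col e) + (\<Sum>v\<in>e. real (md v))) \<le> x ^ (u + 1) * C"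
      by (rule mult_left_mono[OF *(2) zero_le_power[OF x0]])
    moreover have "K' * x ^ u \<le> K' * x ^ (u + 1)"
      using x1 K'0 by (intro mult_left_mono power_increasing) auto
    moreover have "(C + K') * x ^ (u + 1) = x ^ (u + 1) * C + K' * x ^ (u + 1)"
      by (simp only: distrib_right mult.commute[of C])
    ultimately show ?thesis using *(1) unfolding K'_def[symmetric] by linarith
  qed
  then have "real (card F) * (x ^ (u + 2) - (C + K') * x ^ (u + 1)) \<le> (\<Sum>e\<in>F. real (card (ext e)))"
    by (rule sum_bounded_below)
  also have "\<dots> \<le> N" by (rule sum_N[OF F(1)])
  finally have "(real s + 1) * (x ^ (u + 2) - (C + K') * x ^ (u + 1)) \<le> real s * x ^ (u + 2)"
    using N_le unfolding F(2) of_nat_add of_nat_1 by linarith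
  then have "x * x ^ (u + 1) \<le> ((real s + 1) * (C + K')) * x ^ (u + 1)"
    by (simp add: algebra_simps)
  then have "x \<le> (real s + 1) * (C + K')"
    using x1 by (subst (asm) mult_le_cancel_right) auto
  then show False using big by (simp add: K'_def)
qed

text \<open>In a matching no vertex is charged twice. This gives \<open>M\<close> the coefficient
  one in the first-order term.\<close>

lemma sum_md_B_le:
  assumes "pairwise disjnt B"
  shows "(\<Sum>e\<in>B. \<Sum>v\<in>e. real (md v)) \<le> M"
proof -
  have sub: "e \<subseteq> V \<and> finite e" if "e \<in> B" for e using that by (auto elim!: B_E)
  have "(\<Sum>e\<in>B. \<Sum>v\<in>e. real (md v)) = (\<Sum>v\<in>\<Union>B. real (md v))"
    using sub assms sum.Union_disjoint[of B "\<lambda>v. real (md v)"]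
    by (simp add: pairwise_def disjnt_def)
  also have "\<dots> \<le> (\<Sum>v\<in>V. real (md v))"
    using sub finV by (intro sum_mono2) auto
  also have "\<dots> = M" using sum_md by (simp flip: of_nat_sum)
  finally show ?thesis .
qed

text \<open>Missing pairs use up part of the fixed total \<open>M + D\<close>. The square identity
  turns this into \<open>d\<^sup>2 \<le> g\<^sup>2 - M * g / r\<close>, and replacing the square by
  its tangent at \<open>g\<close> leaves the linear loss \<open>M / (2 * r)\<close>, to be compared
  with \<open>s > 2 * r\<close>.\<close>

lemma dev_le:
  assumes "t < s" "card B = s" "j < p"
  defines "r \<equiv> R (p + 1) n s t"
  shows "dev V f p j \<le> (real p - 1) * r / p - M / (2 * r)"
    and "M + D = r\<^sup>2 * (real p - 1) / p"
proof -
  have r: "r > 0" "r\<^sup>2 * (real p - 1) / p = 2 * (real s - real t) + (real p - real (n mod p)) * real (n mod p) / p"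
    unfolding r_def by (rule R_props; use assms p_pos in simp)+
  show MD: "M + D = r\<^sup>2 * (real p - 1) / p"
    using count r(2) assms(2) by simp
  define g where "g = (real p - 1) * r / p"
  have g: "g > 0" using r p_pos by (simp add: g_def)
  have "0 \<le> (\<Sum>i\<in>{..<p} - {j}. (dev V f p i + dev V f p j / (real p - 1))\<^sup>2)"
    by (intro sum_nonneg) auto
  then have "p * (dev V f p j)\<^sup>2 / (real p - 1) \<le> D"
    using sum_zero_square_identity[OF sum_dev[OF finV f p_pos(1)] assms(3)] p_pos by simp
  then have "(dev V f p j)\<^sup>2 \<le> (real p - 1) / p * D"
    using p_pos by (simp add: field_simps)
  also have "\<dots> = (real p - 1) / p * (r\<^sup>2 * (real p - 1) / p - M)" using MD by (metis add_diff_cancel_left')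
  also have "\<dots> = g\<^sup>2 - M * g / r"
    using r(1) p_pos by (simp add: g_def field_simps power2_eq_square)
  finally have "(dev V f p j)\<^sup>2 \<le> g\<^sup>2 - M * g / r" .
  moreover have "2 * g * dev V f p j \<le> g\<^sup>2 + (dev V f p j)\<^sup>2"
    using zero_le_power2[of "g - dev V f p j"] by (simp add: power2_diff)
  moreover have "2 * g * (g - M / (2 * r)) = 2 * g\<^sup>2 - M * g / r"
    using r(1) by (simp add: power2_eq_square field_simps)
  ultimately have "2 * g * dev V f p j \<le> 2 * g * (g - M / (2 * r))"
    by linarith
  then show "dev V f p j \<le> (real p - 1) * r / p - M / (2 * r)"
    using g unfolding g_def[symmetric] by (subst (asm) mult_le_cancel_left_pos) auto
qed

text \<open>The lower bound on \<open>N\<close> and the expansion of the assumed upper bound have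
  the same leading term, so their first-order coefficients \<open>X\<close> and \<open>s * g\<close>
  can be compared. The gap upgrades an approximate inequality to \<open>s * g \<le> X\<close>, and
  \<open>dev_le\<close> then forces equality throughout.\<close>

lemma extremal_structure:
  fixes x r :: real
  assumes x: "x = real n / p" and r_def: "r = R (p + 1) n s t"
    and K: "\<forall>J (y::nat\<Rightarrow>real). finite J \<and> card J = u + 2 \<and> (\<forall>j\<in>J. \<bar>y j\<bar> \<le> C) \<longrightarrow>
      \<bar>(\<Prod>j\<in>J. x + y j) - x ^ (u + 2) - x ^ (u + 1) * (\<Sum>j\<in>J. y j)\<bar> \<le> K * x ^ u"
    and MD: "M + D \<le> C\<^sub>1" and C: "3 * C\<^sub>1 + 1 \<le> C" "r / p \<le> C" and x1: "x \<ge> 1"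
    and ts: "t < s" and B: "card B = s" "pairwise disjnt B" and s2r: "real s > 2 * r"
    and N_le: "N \<le> real s * n_minus (p + 1) n s t ^ (u + 2)"
    and gap: "\<And>a::int. real_of_int a < s * (real p - 1) * r \<Longrightarrow> \<delta> \<le> s * (real p - 1) * r - real_of_int a"
    and big: "x * \<delta> > real p * (s * (2 * K + C\<^sub>1 * real p ^ u))"
  shows "M = 0" "\<And>e. e \<in> B \<Longrightarrow> dev V f p (col e) = (real p - 1) * r / p"
    "D = r\<^sup>2 * (real p - 1) / p"
proof -
  define g where "g = (real p - 1) * r / p"
  define X where "X = (\<Sum>e\<in>B. dev V f p (col e)) + M"
  have r: "r > 0" unfolding r_def by (rule R_props) (use ts p_pos in auto)
  have "real s * (x ^ (u + 2) - (K + C\<^sub>1 * real p ^ u) * x ^ u) - x ^ (u + 1) * X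
      \<le> real s * (x ^ (u + 2) - (K + C\<^sub>1 * real p ^ u) * x ^ u)
        - x ^ (u + 1) * ((\<Sum>e\<in>B. dev V f p (col e)) + (\<Sum>e\<in>B. \<Sum>v\<in>e. real (md v)))"
    unfolding X_def using sum_md_B_le[OF B(2)] x1 by (intro diff_left_mono mult_left_mono) auto
  also have "\<dots> = (\<Sum>e\<in>B. x ^ (u + 2) - x ^ (u + 1) * (dev V f p (col e) + (\<Sum>v\<in>e. real (md v))) - (K + C\<^sub>1 * real p ^ u) * x ^ u)"
    by (simp add: sum_subtractf B(1) right_diff_distrib flip: sum_distrib_left sum.distrib)
  also have "\<dots> \<le> (\<Sum>e\<in>B. real (card (ext e)))"
    by (intro sum_mono card_ext_ge(1)[OF x K MD C(1)])
  also have "\<dots> \<le> N" by (rule sum_N) simp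
  finally have low: "real s * (x ^ (u + 2) - (K + C\<^sub>1 * real p ^ u) * x ^ u) - x ^ (u + 1) * X \<le> N" .
  \<comment> \<open>All increments equal \<open>- (r / p)\<close>; as \<open>u + 2 = p - 1\<close>,
    they add up to \<open>- g\<close>.\<close>
  have "\<bar>(\<Prod>j<u + 2. x + - (r / p)) - x ^ (u + 2) - x ^ (u + 1) * (\<Sum>j<u + 2. - (r / p))\<bar> \<le> K * x ^ u"
    using C(2) r by (intro K[rule_format]) auto
  then have "(x - r / p) ^ (u + 2) \<le> x ^ (u + 2) - x ^ (u + 1) * g + K * x ^ u"
    by (simp add: abs_le_iff g_def p_eq)
  then have "N \<le> real s * (x ^ (u + 2) - x ^ (u + 1) * g + K * x ^ u)"
    using N_le unfolding n_minus_eq r_def[symmetric] x[symmetric]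
    by (meson mult_left_mono of_nat_0_le_iff order_trans)
  with low have "x ^ (u + 1) * (s * g - X) \<le> s * (2 * K + C\<^sub>1 * real p ^ u) * x ^ u"
    by (simp add: algebra_simps)
  then have "(x * (s * g - X)) * x ^ u \<le> (s * (2 * K + C\<^sub>1 * real p ^ u)) * x ^ u"
    by (simp add: algebra_simps)
  then have Xg: "x * (s * g - X) \<le> s * (2 * K + C\<^sub>1 * real p ^ u)"
    using x1 by (subst (asm) mult_le_cancel_right) auto
  \<comment> \<open>This is \<open>p * X\<close> as an integer. By \<open>gap\<close> it cannot lie
    below \<open>s * (p - 1) * r\<close> by less than \<open>\<delta>\<close>, and
    \<open>big\<close> excludes a larger shortfall.\<close>
  define a :: int where "a = (\<Sum>e\<in>B. int p * int (card {v\<in>V. f v = col e}) - int n) + int p * int (card (missing V E f))"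
  have a: "real_of_int a = p * X"
  proof -
    have "p * dev V f p (col e) = real p * card {v\<in>V. f v = col e} - n" for e
      using p_pos by (simp add: dev_def card_V algebra_simps)
    then have "p * X = (\<Sum>e\<in>B. real p * card {v\<in>V. f v = col e} - n) + p * M"
      unfolding X_def distrib_left sum_distrib_left by simp
    then show ?thesis by (simp add: a_def)
  qed
  have Xge: "s * g \<le> X"
  proof (rule ccontr)
    assume "\<not> s * g \<le> X"
    then have "p * X < p * (s * g)" using p_pos by (intro mult_strict_left_mono) auto
    moreover have pg: "p * (s * g) = s * (real p - 1) * r" using p_pos by (simp add: g_def)
    ultimately have "\<delta> \<le> p * (s * g) - p * X" using gap[of a] by (simp only: a pg)
    then have "x * \<delta> \<le> x * (p * (s * g) - p * X)" using x1 by (intro mult_left_mono) auto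
    also have "\<dots> = p * (x * (s * g - X))" by (simp add: algebra_simps)
    also have "\<dots> \<le> p * (s * (2 * K + C\<^sub>1 * real p ^ u))" using Xg by (intro mult_left_mono) auto
    finally show False using big by simp
  qed
  have devB: "dev V f p (col e) \<le> g - M / (2 * r)" if "e \<in> B" for e
    using dev_le(1)[OF ts B(1) col_less[OF that]] by (simp add: g_def r_def)
  have "(\<Sum>e\<in>B. dev V f p (col e)) \<le> s * (g - M / (2 * r))"
    using sum_bounded_above[of B "\<lambda>e. dev V f p (col e)", OF devB] B(1) by simp
  \<comment> \<open>A missing pair adds one to \<open>X\<close> but lowers the bound on each of the
    \<open>s\<close> deviations by \<open>1 / (2 * r)\<close>, a net loss because
    \<open>s > 2 * r\<close>.\<close>
  then have "M * (s / (2 * r)) \<le> M" using Xge by (simp add: X_def algebra_simps)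
  moreover have "s / (2 * r) > 1" using s2r r by simp
  ultimately show M0: "M = 0"
    by (smt (verit, best) mult_le_cancel_left2 of_nat_0_le_iff)
  show "D = r\<^sup>2 * (real p - 1) / p"
    using dev_le(2)[OF ts B(1) p_pos(1)] M0 by (simp add: r_def)
  fix e assume eB: "e \<in> B"
  show "dev V f p (col e) = (real p - 1) * r / p"
  proof (rule ccontr)
    assume "dev V f p (col e) \<noteq> (real p - 1) * r / p"
    then have "dev V f p (col e) < g" using devB[OF eB] M0 by (simp add: g_def)
    then have "(\<Sum>e\<in>B. dev V f p (col e)) < (\<Sum>e\<in>B. g)"
      using devB M0 eB finB by (intro sum_strict_mono_ex1) auto
    then show False using Xge M0 B(1) by (simp add: X_def)
  qed
qed

end

context coloured_graph
begin

text \<open>One vertex from each monochromatic edge covers all copies, so there are at least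
  \<open>s\<close> edges. If two of them shared a vertex, it could serve both and save a vertex of
  the cover.\<close>

lemma matching_of_cover:
  assumes "\<tau> (p + 1) \<lparr>verts = V, edges = E\<rparr> = s" "card B \<le> s"
  shows "card B = s" "pairwise disjnt B"
proof -
  define pick where "pick e = (SOME v. v \<in> e)" for e :: "'a set"
  have pick: "pick e \<in> e" if "e \<in> B" for e
    using that unfolding pick_def some_in_eq by (auto elim!: B_E)
  have BV: "e \<subseteq> V" if "e \<in> B" for e using that by (auto elim!: B_E)
  have cover: "s \<le> card S" if "S \<subseteq> V" "\<And>e. e \<in> B \<Longrightarrow> S \<inter> e \<noteq> {}" for S
    using tau_le_cover_mono[OF finV f that(1), of E] that(2) assms(1) by simp
  have "s \<le> card (pick ` B)" by (rule cover) (use pick BV in blast)+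
  then show sB: "card B = s" using card_image_le[OF finB, of pick] assms(2) by simp
  show "pairwise disjnt B"
  proof (rule ccontr)
    assume "\<not> pairwise disjnt B"
    then obtain e e' v where e: "e \<in> B" "e' \<in> B" "e \<noteq> e'" "v \<in> e" "v \<in> e'"
      by (auto simp: pairwise_def disjnt_iff)
    let ?S = "insert v (pick ` (B - {e, e'}))"
    have "s \<le> card ?S"
    proof (rule cover)
      show "?S \<subseteq> V" using pick BV e by blast
      show "?S \<inter> d \<noteq> {}" if "d \<in> B" for d
        using pick[OF that] e that by (cases "d \<in> {e, e'}") auto
    qed
    also have "\<dots> \<le> Suc (card (pick ` (B - {e, e'})))" by (simp add: card_insert_if finB)
    also have "\<dots> \<le> Suc (card (B - {e, e'}))" using finB by (simp add: card_image_le)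
    also have "card (B - {e, e'}) = s - 2" using e finB sB by (simp add: card_Diff_subset)
    finally have "s \<le> Suc (s - 2)" .
    \<comment> \<open>Two distinct edges force \<open>s \<ge> 2\<close>, so the subtraction
      \<open>s - 2\<close> does not truncate.\<close>
    moreover have "card {e, e'} \<le> s" unfolding sB[symmetric] using e finB by (intro card_mono) auto
    ultimately show False using e(3) by simp
  qed
qed

end

section \<open>Thresholds for large \<open>n\<close> and the structure of graphs attaining the
  bound\<close>

lemma eventually_linear_greater:
  assumes "c > 0"
  shows "\<forall>\<^sub>F n in sequentially. d < c * real n"
proof -
  have "\<forall>\<^sub>F n in sequentially. d / c < real n"
    using filterlim_real_sequentially filterlim_at_top_dense by blast
  then show ?thesis by eventually_elim (use assms in \<open>simp add: field_simps\<close>)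
qed

text \<open>Fueredi's colouring, compared with the Turan number, has linearly many monochromatic
  edges. A colouring with the fewest inherits this bound and is locally optimal as well.\<close>

lemma max_cut_colouring:
  assumes "finite V" "E \<subseteq> [V]\<^bsup>2\<^esup>" "p > 0" "card V = n" "card E = turan_number p n + t"
    "\<tau> (p + 1) \<lparr>verts = V, edges = E\<rparr> = s"
  obtains f where "f \<in> V \<rightarrow> {..<p}"
    "\<And>g. g \<in> V \<rightarrow> {..<p} \<Longrightarrow> card (mono_edges E f) \<le> card (mono_edges E g)"
    "2 * real (card (mono_edges E f)) \<le> 4 * real s * n + p"
proof -
  have "simple_graph \<lparr>verts = V, edges = E\<rparr>" using assms by (simp add: simple_graph_def)
  then obtain S where S: "S \<subseteq> V" "card S = s"
    "\<And>W. W \<in> clique_copies (p + 1) \<lparr>verts = V, edges = E\<rparr> \<Longrightarrow> S \<inter> W \<noteq> {}"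
    using tau_cover[of "\<lparr>verts = V, edges = E\<rparr>" "p + 1"] assms(6) by auto
  have "S \<inter> W \<noteq> {}" if "W \<subseteq> V" "card W = Suc p" "clique W E" for W
    using S(3)[of W] that assms(1) finite_subset by (auto simp: clique_copies_def nsets_def)
  from initial_colouring[OF assms(1,2) S(1) assms(3) this]
  obtain f\<^sub>0 where f0: "f\<^sub>0 \<in> V \<rightarrow> {..<p}"
    "card (arcs E) + card (arcs (mono_edges E f\<^sub>0)) \<le> card (cross V f\<^sub>0) + 4 * (s * n)"
    using S(2) assms(4) by auto
  obtain f where f: "f \<in> V \<rightarrow> {..<p}"
    "\<And>g. g \<in> V \<rightarrow> {..<p} \<Longrightarrow> card (mono_edges E f) \<le> card (mono_edges E g)"
    using ex_has_least_nat[of "\<lambda>f. f \<in> V \<rightarrow> {..<p}" f\<^sub>0 "\<lambda>f. card (mono_edges E f)"] f0(1) by blast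
  have m: "mono_edges E f\<^sub>0 \<subseteq> [V]\<^bsup>2\<^esup>" using assms(2) mono_edges_subset by blast
  have "real (2 * card E) + real (2 * card (mono_edges E f\<^sub>0)) \<le> real (card (cross V f\<^sub>0)) + 4 * (real s * n)"
    using f0(2) unfolding card_arcs[OF assms(1,2)] card_arcs[OF assms(1) m]
    by (simp flip: of_nat_add of_nat_mult)
  moreover have "real (card (cross V f\<^sub>0)) \<le> (real n)\<^sup>2 - (real n)\<^sup>2 / p"
    using card_cross_dev[OF assms(1) f0(1) assms(3)] assms(4) by (simp add: sum_nonneg)
  ultimately have "2 * real (card (mono_edges E f\<^sub>0)) \<le> 4 * real s * n + p"
    using turan_number_eq[OF assms(3), of n] remainder_term_bounds(2)[OF assms(3), of n] assms(5) by simp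
  then have "2 * real (card (mono_edges E f)) \<le> 4 * real s * n + p"
    using f(2)[OF f0(1)] by linarith
  then show thesis using f that by blast
qed

text \<open>The graph is quantified inside the filter, so the threshold depends on \<open>s\<close>,
  \<open>t\<close> and \<open>u\<close> only. The proof bootstraps: the number of monochromatic
  edges is bounded linearly, then by a constant, then by \<open>s\<close>.\<close>

lemma few_cliques_structure:
  fixes s t u :: nat
  assumes "t < s"
  defines "p \<equiv> u + 3"
  shows "\<forall>\<^sub>F n in sequentially. \<forall>(V :: 'a set) E.
    finite V \<and> E \<subseteq> [V]\<^bsup>2\<^esup> \<and> card V = n \<and> card E = turan_number p n + t \<and>
    \<tau> (p + 1) \<lparr>verts = V, edges = E\<rparr> = s \<and> real s > 2 * R (p + 1) n s t \<and>
    real (N_cliques (p + 1) \<lparr>verts = V, edges = E\<rparr>) \<le> real s * n_minus (p + 1) n s t ^ (u + 2)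
    \<longrightarrow> (\<exists>f \<in> V \<rightarrow> {..<p}. missing V E f = {} \<and> card (mono_edges E f) = s \<and>
      pairwise disjnt (mono_edges E f) \<and>
      (\<forall>e\<in>mono_edges E f. dev V f p (the_elem (f ` e)) = (real p - 1) * R (p + 1) n s t / p) \<and>
      (\<Sum>j<p. (dev V f p j)\<^sup>2) = (R (p + 1) n s t)\<^sup>2 * (real p - 1) / p)"
proof -
  have p_eq: "p = u + 3" by (simp add: p_def)
  have pp: "real p > 0" "p > 0" "p > 1" "real p \<ge> 1" by (auto simp: p_def)
  \<comment> \<open>\<open>L * n\<close> bounds \<open>M + D\<close> as long as only the linear
    bound is known, and \<open>C1\<close> does so once there are at most \<open>s / \<kappa>\<close>
    monochromatic edges. \<open>C\<close> also dominates every value of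
    \<open>R / p\<close>.\<close>
  define L where "L = 4 * real s + 2 * real p"
  define \<kappa> where "\<kappa> = (1 / (2 * real p)) ^ (u + 2) / 2"
  define C1 where "C1 = 2 * (s / \<kappa>) + p"
  define Rmax where "Rmax = (\<Sum>r<p. R (p + 1) r s t)"
  define C where "C = 3 * C1 + 1 + Rmax"
  \<comment> \<open>\<open>h\<close> is \<open>p\<close> times the target value of \<open>X\<close>.
    Since \<open>\<lceil>h r\<rceil> - 1\<close> is the largest integer strictly below
    \<open>h r\<close>, even when \<open>h r\<close> is an integer, \<open>\<delta>\<close> is a
    positive gap valid for all residues.\<close>
  define h where "h r = s * (real p - 1) * R (p + 1) r s t" for r
  define \<delta> where "\<delta> = Min ((\<lambda>r. h r - (of_int \<lceil>h r\<rceil> - 1)) ` {..<p})"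
  have kpos: "\<kappa> > 0" using pp by (simp add: \<kappa>_def)
  have Rpos: "R (p + 1) n s t > 0" for n using R_props(1)[OF assms(1) pp(3)] .
  have Rmax: "R (p + 1) n s t \<le> Rmax" for n
  proof -
    have "R (p + 1) (n mod p) s t \<le> Rmax"
      unfolding Rmax_def by (rule member_le_sum) (use pp Rpos in \<open>auto intro: less_imp_le\<close>)
    then show ?thesis by (subst R_mod)
  qed
  have C1: "C1 \<ge> 0" using kpos by (simp add: C1_def)
  have Rmax0: "Rmax \<ge> 0" using Rpos[of 0] Rmax[of 0] by linarith
  have C0: "C \<ge> 0" using C1 Rmax0 by (simp add: C_def)
  obtain K where K: "K \<ge> 0" "\<And>J (y::nat\<Rightarrow>real) x. finite J \<Longrightarrow> card J = u + 2 \<Longrightarrow> (\<And>j. j \<in> J \<Longrightarrow> \<bar>y j\<bar> \<le> C) \<Longrightarrow>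
    x \<ge> 1 \<Longrightarrow> \<bar>(\<Prod>j\<in>J. x + y j) - x ^ (u + 2) - x ^ (u + 1) * (\<Sum>j\<in>J. y j)\<bar> \<le> K * x ^ u"
    using prod_plus_approx[OF C0, of u] by metis
  have \<delta>: "\<delta> > 0"
  proof -
    have "0 < h r - (of_int \<lceil>h r\<rceil> - 1)" for r by linarith
    then show ?thesis unfolding \<delta>_def using pp by (subst Min_gr_iff) auto
  qed
  have gap: "\<delta> \<le> h (n mod p) - of_int a" if "of_int a < h (n mod p)" for n and a :: int
  proof -
    have "a \<le> \<lceil>h (n mod p)\<rceil> - 1" using that by (simp add: less_ceiling_iff)
    then have "real_of_int a \<le> of_int \<lceil>h (n mod p)\<rceil> - 1" by linarith
    moreover have "\<delta> \<le> h (n mod p) - (of_int \<lceil>h (n mod p)\<rceil> - 1)"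
      unfolding \<delta>_def using pp by (intro Min_le) auto
    ultimately show ?thesis by linarith
  qed
  \<comment> \<open>In order, these serve small monochromatic degrees, nearly equal classes, the
    reserve in \<open>\<kappa>\<close>, the absence of vertices with many missing pairs,
    \<open>x \<ge> 1\<close>, at most \<open>s\<close> monochromatic edges, the integrality gap, and
    nonnegativity of \<open>n_minus\<close>.\<close>
  have ev: "\<forall>\<^sub>F n in sequentially. s + L < (1 / (32 * real p)) ^ p * real n"
    "\<forall>\<^sub>F n in sequentially. 16 * (real p)\<^sup>2 * L < 1 * real n"
    "\<forall>\<^sub>F n in sequentially. L < \<kappa> * real n"
    "\<forall>\<^sub>F n in sequentially. s / \<kappa> + p / 2 < 1 / (32 * real p) * real n"
    "\<forall>\<^sub>F n in sequentially. 1 < (1 / real p) * real n"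
    "\<forall>\<^sub>F n in sequentially. (real s + 1) * (C + (K + C1 * real p ^ u)) < (1 / real p) * real n"
    "\<forall>\<^sub>F n in sequentially. real p * (s * (2 * K + C1 * real p ^ u)) < (\<delta> / p) * real n"
    "\<forall>\<^sub>F n in sequentially. Rmax < 1 * real n"
    by (rule eventually_linear_greater; use pp kpos \<delta> in simp)+
  from eventually_conj[OF ev(1) eventually_conj[OF ev(2) eventually_conj[OF ev(3) eventually_conj[OF ev(4)
    eventually_conj[OF ev(5) eventually_conj[OF ev(6) eventually_conj[OF ev(7) ev(8)]]]]]]]
  show ?thesis
  proof (rule eventually_mono, intro allI impI, elim conjE)
    fix n and V :: "'a set" and E
    assume T: "s + L < (1 / (32 * real p)) ^ p * real n" "16 * (real p)\<^sup>2 * L < 1 * real n"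
      "L < \<kappa> * real n" "s / \<kappa> + p / 2 < 1 / (32 * real p) * real n" "1 < (1 / real p) * real n"
      "(real s + 1) * (C + (K + C1 * real p ^ u)) < (1 / real p) * real n"
      "real p * (s * (2 * K + C1 * real p ^ u)) < (\<delta> / p) * real n" "Rmax < 1 * real n"
      and G: "finite V" "E \<subseteq> [V]\<^bsup>2\<^esup>" "card V = n" "card E = turan_number p n + t"
      "\<tau> (p + 1) \<lparr>verts = V, edges = E\<rparr> = s" and s2R: "real s > 2 * R (p + 1) n s t"
      and Nle: "real (N_cliques (p + 1) \<lparr>verts = V, edges = E\<rparr>) \<le> real s * n_minus (p + 1) n s t ^ (u + 2)"
    define r where "r = R (p + 1) n s t"
    define x where "x = real n / p"
    obtain f where fm: "f \<in> V \<rightarrow> {..<p}"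
      "\<And>g. g \<in> V \<rightarrow> {..<p} \<Longrightarrow> card (mono_edges E f) \<le> card (mono_edges E g)"
      "2 * real (card (mono_edges E f)) \<le> 4 * real s * n + p"
      using max_cut_colouring[OF G(1,2) pp(2) G(3-5)] by blast
    have n0: "n > 0" using T(5) by (cases n) auto
    interpret coloured_graph V E f p u n s t
      by unfold_locales (use G fm(1) p_eq n0 in auto)
    have x1: "x \<ge> 1" using T(5) by (simp add: x_def)
    have "real p * 1 \<le> p * real n" using n0 by (intro mult_left_mono) auto
    then have MD: "M + D \<le> L * n" using M_D_le fm(3) unfolding L_def by (simp add: algebra_simps)
    then have Mle: "M \<le> L * n" using D_nonneg by linarith
    have nm: "0 \<le> n_minus (p + 1) n s t" "n_minus (p + 1) n s t \<le> x"
      using Rmax[of n] Rpos[of n] T(8) pp unfolding n_minus_eq x_def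
      by (auto simp: divide_right_mono)
    have Nx: "N \<le> real s * x ^ (u + 2)"
      by (rule order_trans[OF Nle]) (use nm in \<open>intro mult_left_mono power_mono, auto\<close>)
    have "x \<le> n" using pp n0 by (simp add: x_def divide_le_eq)
    then have Nn: "N \<le> real s * real n ^ (u + 2)"
      by (intro order_trans[OF Nx] mult_left_mono power_mono) (use x1 in auto)
    have deg: "real (card {y. {v, y} \<in> E \<and> f y = f v}) < (1 / (32 * real p)) * n" if "v \<in> V" for v
      by (rule mono_degree_less[OF fm(2) Mle Nn]) (use pp T(1) that in auto)
    have part: "3 * real n / (4 * real p) \<le> card {v\<in>V. f v = j}" if "j < p" for j
    proof -
      have "(dev V f p j)\<^sup>2 \<le> L * n" using dev_square_le[OF that] MD by linarith
      also have "\<dots> \<le> (n / (16 * (real p)\<^sup>2)) * n"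
        using T(2) pp by (intro mult_right_mono) (auto simp: field_simps)
      also have "\<dots> = (n / (4 * real p))\<^sup>2" by (simp add: power2_eq_square)
      finally have "\<bar>dev V f p j\<bar> \<le> n / (4 * real p)"
        by (subst (asm) abs_le_square_iff[symmetric]) auto
      moreover have "3 * real n / (4 * real p) = n / p - n / (4 * real p)" using pp by (simp add: field_simps)
      ultimately show ?thesis using card_part[of j] by linarith
    qed
    have "real (card B) \<le> s / \<kappa>"
      unfolding \<kappa>_def by (rule card_B_le[OF deg Mle part Nn]) (use T(3,4) in \<open>auto simp: \<kappa>_def\<close>)
    then have MD1: "M + D \<le> C1" using M_D_le by (simp add: C1_def)
    have CC: "3 * C1 + 1 \<le> C" using Rmax0 by (simp add: C_def)
    have Kx: "\<forall>J (y::nat\<Rightarrow>real). finite J \<and> card J = u + 2 \<and> (\<forall>j\<in>J. \<bar>y j\<bar> \<le> C) \<longrightarrow>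
        \<bar>(\<Prod>j\<in>J. x + y j) - x ^ (u + 2) - x ^ (u + 1) * (\<Sum>j\<in>J. y j)\<bar> \<le> K * x ^ u"
      using K(2) x1 by blast
    have "card B \<le> s"
      by (rule card_B_le_s[OF x_def Kx K(1) MD1 CC x1 Nx]) (use T(6) in \<open>auto simp: x_def\<close>)
    note B = matching_of_cover[OF G(5) this]
    have rC: "r / p \<le> C"
    proof -
      have "r / p \<le> r" using Rpos[of n] pp by (simp add: r_def divide_le_eq)
      also have "r \<le> C" using Rmax[of n] C1 by (simp add: r_def C_def)
      finally show ?thesis .
    qed
    have gap': "\<delta> \<le> s * (real p - 1) * r - real_of_int a" if "real_of_int a < s * (real p - 1) * r" for a
      using gap[of a n] that unfolding h_def r_def R_mod[of p n s t, symmetric] by blast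
    have big: "x * \<delta> > real p * (s * (2 * K + C1 * real p ^ u))"
      using T(7) by (simp add: x_def mult.commute)
    note st = extremal_structure[OF x_def r_def Kx MD1 CC rC x1 assms(1) B s2R[folded r_def] Nle gap' big]
    have "missing V E f = {}" using st(1) finV by simp
    then show "\<exists>f \<in> V \<rightarrow> {..<p}. missing V E f = {} \<and> card (mono_edges E f) = s \<and>
      pairwise disjnt (mono_edges E f) \<and>
      (\<forall>e\<in>mono_edges E f. dev V f p (the_elem (f ` e)) = (real p - 1) * R (p + 1) n s t / p) \<and>
      (\<Sum>j<p. (dev V f p j)\<^sup>2) = (R (p + 1) n s t)\<^sup>2 * (real p - 1) / p"
      using B st(2,3) fm(1) unfolding r_def by blast
  qed
qed

section \<open>The extremal graph\<close>

lemma graph_iso_sym: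
  assumes "graph_iso G H"
  shows "graph_iso H G"
proof -
  obtain \<phi> where \<phi>: "bij_betw \<phi> (verts G) (verts H)"
    "\<And>x y. x \<in> verts G \<Longrightarrow> y \<in> verts G \<Longrightarrow> {x, y} \<in> edges G \<longleftrightarrow> {\<phi> x, \<phi> y} \<in> edges H"
    using assms by (auto simp: graph_iso_def)
  let ?g = "inv_into (verts G) \<phi>"
  have g: "?g x \<in> verts G" "\<phi> (?g x) = x" if "x \<in> verts H" for x
    using \<phi>(1) that by (auto simp: bij_betw_def inv_into_into f_inv_into_f)
  have "{x, y} \<in> edges H \<longleftrightarrow> {?g x, ?g y} \<in> edges G" if "x \<in> verts H" "y \<in> verts H" for x y
    using \<phi>(2)[of "?g x" "?g y"] g that by simp
  then show ?thesis
    unfolding graph_iso_def using bij_betw_inv_into[OF \<phi>(1)] by blast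
qed

text \<open>An isomorphism maps copies injectively to copies; this carries the upper bound for the
  model graph over to \<open>G\<close>.\<close>

lemma N_cliques_iso_le:
  assumes "graph_iso G H" "finite (verts H)"
  shows "N_cliques k G \<le> N_cliques k H"
proof -
  obtain \<phi> where \<phi>: "bij_betw \<phi> (verts G) (verts H)"
    "\<And>x y. x \<in> verts G \<Longrightarrow> y \<in> verts G \<Longrightarrow> {x, y} \<in> edges G \<longleftrightarrow> {\<phi> x, \<phi> y} \<in> edges H"
    using assms by (auto simp: graph_iso_def)
  have inj: "inj_on \<phi> (verts G)" and im: "\<phi> ` verts G = verts H"
    using \<phi>(1) by (auto simp: bij_betw_def)
  have "inj_on ((`) \<phi>) (clique_copies k G)"
    by (rule inj_on_subset[OF inj_on_image_Pow[OF inj]]) (auto simp: clique_copies_def nsets_def)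
  moreover have "(`) \<phi> ` clique_copies k G \<subseteq> clique_copies k H"
  proof
    fix X assume "X \<in> (`) \<phi> ` clique_copies k G"
    then obtain W where W: "X = \<phi> ` W" "W \<subseteq> verts G" "finite W" "card W = k" "clique W (edges G)"
      by (auto simp: clique_copies_def nsets_def)
    have "card X = k" using W inj by (metis card_image inj_on_subset)
    moreover have "clique X (edges H)"
      unfolding clique_def
    proof (intro ballI impI)
      fix a b assume "a \<in> X" "b \<in> X" "a \<noteq> b"
      then obtain v w where vw: "v \<in> W" "w \<in> W" "a = \<phi> v" "b = \<phi> w" "v \<noteq> w" using W(1) by blast
      then have "{v, w} \<in> edges G" using W(5) by (simp add: clique_def)
      then show "{a, b} \<in> edges H" using \<phi>(2)[of v w] vw W(2) by auto
    qed
    ultimately show "X \<in> clique_copies k H"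
      using W im by (auto simp: clique_copies_def nsets_def)
  qed
  moreover have "finite (clique_copies k H)"
    using assms(2) by (auto simp: clique_copies_def finite_imp_finite_nsets)
  ultimately show ?thesis unfolding N_cliques_def by (rule card_inj_on_le)
qed

text \<open>This is \<open>KM\<close> with natural part sizes, which keeps the combinatorics apart
  from the real numbers \<open>n_plus\<close>, \<open>n_minus\<close> and their floors.\<close>

definition matching_multipartite :: "nat \<Rightarrow> nat \<Rightarrow> nat \<Rightarrow> nat \<Rightarrow> (nat \<times> nat) ugraph" where
  "matching_multipartite p a b s =
     (let K = complete_multipartite p (\<lambda>i. if i = 0 then a else b)
      in \<lparr>verts = verts K, edges = edges K \<union> {{(0, 2 * i), (0, 2 * i + 1)} | i. i < s}\<rparr>)"

lemma KM_eq: "KM n k s t = matching_multipartite (k - 1) (nat \<lfloor>n_plus k n s t\<rfloor>) (nat \<lfloor>n_minus k n s t\<rfloor>) s"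
  by (simp add: KM_def matching_multipartite_def)

lemma verts_matching_multipartite:
  "verts (matching_multipartite p a b s) = (SIGMA i:{..<p}. {..<if i = 0 then a else b})"
  by (simp add: matching_multipartite_def verts_multipartite Let_def)

lemma edge_matching_multipartite_iff:
  "{v, w} \<in> edges (matching_multipartite p a b s) \<longleftrightarrow>
    v \<in> verts (matching_multipartite p a b s) \<and> w \<in> verts (matching_multipartite p a b s) \<and> fst v \<noteq> fst w
    \<or> (\<exists>i<s. {v, w} = {(0, 2 * i), (0, 2 * i + 1)})"
proof -
  let ?K = "complete_multipartite p (\<lambda>i. if i = 0 then a else b)"
  have "edges (matching_multipartite p a b s) = edges ?K \<union> {{(0, 2 * i), (0, 2 * i + 1)} | i. i < s}"
    "verts (matching_multipartite p a b s) = verts ?K"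
    by (simp_all add: matching_multipartite_def Let_def)
  then show ?thesis using multipartite_edge_iff[of v w p "\<lambda>i. if i = 0 then a else b"] by auto
qed

text \<open>A clique has at most one vertex in each part other than part \<open>0\<close>, and at
  most two in part \<open>0\<close>, where the edges form a matching. So \<open>p + 1\<close>
  vertices force one matching edge and one vertex in each other part, which is what
  \<open>\<Psi>\<close> encodes.\<close>

lemma N_cliques_matching_multipartite_le:
  assumes "p > 0"
  shows "N_cliques (p + 1) (matching_multipartite p a b s) \<le> s * b ^ (p - 1)"
proof -
  let ?G = "matching_multipartite p a b s"
  let ?Dom = "{..<s} \<times> Pi\<^sub>E {1..<p} (\<lambda>_. {..<b})"
  define \<Psi> :: "nat \<times> (nat \<Rightarrow> nat) \<Rightarrow> (nat \<times> nat) set"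
    where "\<Psi> = (\<lambda>(i, g). {(0, 2 * i), (0, 2 * i + 1)} \<union> (\<lambda>j. (j, g j)) ` {1..<p})"
  have "clique_copies (p + 1) ?G \<subseteq> \<Psi> ` ?Dom"
  proof
    fix W assume "W \<in> clique_copies (p + 1) ?G"
    then have W: "W \<subseteq> verts ?G" "finite W" "card W = p + 1" "clique W (edges ?G)"
      by (auto simp: clique_copies_def nsets_def)
    have same: "\<exists>i<s. {v, w} = {(0, 2 * i), (0, 2 * i + 1)}"
      if "v \<in> W" "w \<in> W" "v \<noteq> w" "fst v = fst w" for v w
      using W(4) that edge_matching_multipartite_iff[of v w p a b s] unfolding clique_def by blast
    define W0 where "W0 = {v\<in>W. fst v = 0}"
    define W1 where "W1 = W - W0"
    have W01: "W = W0 \<union> W1" "W0 \<inter> W1 = {}" "finite W0" "finite W1"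
      using W(2) by (auto simp: W0_def W1_def)
    have "inj_on fst W1"
    proof (rule inj_onI)
      fix v w assume h: "v \<in> W1" "w \<in> W1" "fst v = fst w"
      show "v = w"
      proof (rule ccontr)
        assume "v \<noteq> w"
        then obtain i where "{v, w} = {(0, 2 * i), (0, 2 * i + 1)}" using same[of v w] h by (auto simp: W1_def)
        then have "fst v = 0" by (auto simp: doubleton_eq_iff)
        then show False using h by (auto simp: W0_def W1_def)
      qed
    qed
    moreover have im: "fst ` W1 \<subseteq> {1..<p}"
      using W(1) by (force simp: W0_def W1_def verts_matching_multipartite)
    ultimately have c1: "card W1 \<le> p - 1" "card (fst ` W1) = card W1"
      using card_mono[OF _ im] by (simp_all add: card_image)
    have c: "card W0 + card W1 = p + 1" using W(3) W01 card_Un_disjoint by metis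
    then have "\<not> card W0 \<le> 1" using c1 assms by linarith
    then obtain v w where vw: "v \<in> W0" "w \<in> W0" "v \<noteq> w"
      using card_le_Suc0_iff_eq[OF W01(3)] by auto
    then obtain i where i: "i < s" "{v, w} = {(0, 2 * i), (0, 2 * i + 1)}"
      using same[of v w] by (auto simp: W0_def)
    have "z = w" if z: "z \<in> W0" "z \<noteq> v" for z
    proof -
      obtain j where "{v, z} = {(0, 2 * j), (0, 2 * j + 1)}"
        using same[of v z] z vw by (auto simp: W0_def)
      \<comment> \<open>Two pairs of the form \<open>2 * i\<close>, \<open>2 * i + 1\<close> that
        share a label coincide, so part \<open>0\<close> has no third clique vertex.\<close>
      then show ?thesis using i(2) by (auto simp: doubleton_eq_iff) presburger+
    qed
    then have "W0 = {v, w}" using vw by blast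
    then have W0: "W0 = {(0, 2 * i), (0, 2 * i + 1)}" using i(2) by (rule trans)
    then have "card W0 = 2" by simp
    then have "fst ` W1 = {1..<p}" using c c1 im by (intro card_subset_eq) auto
    with \<open>inj_on fst W1\<close> have bij: "bij_betw fst W1 {1..<p}" by (simp add: bij_betw_def)
    define g where "g = restrict (\<lambda>j. snd (inv_into W1 fst j)) {1..<p}"
    have inv: "inv_into W1 fst j \<in> W1" "(j, g j) = inv_into W1 fst j" if "j \<in> {1..<p}" for j
    proof -
      show 1: "inv_into W1 fst j \<in> W1" using bij that by (auto simp: bij_betw_def inv_into_into)
      have "fst (inv_into W1 fst j) = j" using bij that by (auto simp: bij_betw_def f_inv_into_f)
      then show "(j, g j) = inv_into W1 fst j" using that by (simp add: g_def prod_eq_iff)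
    qed
    have "W1 = inv_into W1 fst ` {1..<p}" using bij_betw_inv_into[OF bij] by (simp add: bij_betw_def)
    also have "\<dots> = (\<lambda>j. (j, g j)) ` {1..<p}" using inv(2) by (intro image_cong) auto
    finally have "W = \<Psi> (i, g)" using W01(1) W0 by (simp add: \<Psi>_def)
    moreover have "g \<in> Pi\<^sub>E {1..<p} (\<lambda>_. {..<b})"
    proof (rule PiE_I)
      fix j assume j: "j \<in> {1..<p}"
      then have "(j, g j) \<in> verts ?G" using inv[OF j] W(1) W01(1) by auto
      then show "g j \<in> {..<b}" using j by (simp add: verts_matching_multipartite)
    qed (auto simp: g_def)
    ultimately show "W \<in> \<Psi> ` ?Dom" using i(1) by blast
  qed
  then have "N_cliques (p + 1) ?G \<le> card ?Dom"
    unfolding N_cliques_def by (intro surj_card_le finite_cartesian_product finite_PiE) auto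
  then show ?thesis by (simp add: card_cartesian_product card_PiE)
qed

text \<open>The matched vertices are numbered as in \<open>KM\<close>: \<open>m div 2\<close>
  selects the edge and the parity of \<open>m\<close> its endpoint.\<close>

lemma pairing_bij:
  assumes "finite M" "card M = s" "pairwise disjnt M" "\<And>e. e \<in> M \<Longrightarrow> \<exists>x y. x \<noteq> y \<and> e = {x, y}"
  obtains h :: "nat \<Rightarrow> 'a" where "bij_betw h {..<2 * s} (\<Union>M)"
    "bij_betw (\<lambda>i. {h (2 * i), h (2 * i + 1)}) {..<s} M"
proof -
  obtain e where e: "bij_betw e {..<s} M"
    using ex_bij_betw_nat_finite[OF assms(1)] assms(2) by (auto simp: atLeast0LessThan)
  have eM: "e i \<in> M" if "i < s" for i using e that by (auto simp: bij_betw_def)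
  have "\<forall>i<s. \<exists>xy. fst xy \<noteq> snd xy \<and> e i = {fst xy, snd xy}"
    using assms(4)[OF eM] by auto
  then obtain q where q: "\<And>i. i < s \<Longrightarrow> fst (q i) \<noteq> snd (q i)" "\<And>i. i < s \<Longrightarrow> e i = {fst (q i), snd (q i)}"
    by metis
  define h where "h m = (if even m then fst (q (m div 2)) else snd (q (m div 2)))" for m
  have he: "{h (2 * i), h (2 * i + 1)} = e i" if "i < s" for i using q(2)[OF that] by (simp add: h_def)
  have hin: "h m \<in> e (m div 2)" if "m < 2 * s" for m
    using q(2)[of "m div 2"] that by (auto simp: h_def)
  have "inj_on h {..<2 * s}"
  proof (rule inj_onI)
    fix m m' assume m: "m \<in> {..<2 * s}" "m' \<in> {..<2 * s}" and eq: "h m = h m'"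
    then have "h m \<in> e (m div 2)" "h m \<in> e (m' div 2)" using hin[of m] hin[of m'] by auto
    moreover have "e (m div 2) \<in> M" "e (m' div 2) \<in> M" using m eM by auto
    ultimately have "e (m div 2) = e (m' div 2)"
      using assms(3) by (auto simp: pairwise_def disjnt_iff)
    then have d: "m div 2 = m' div 2" using e m by (auto simp: bij_betw_def inj_on_def)
    then have "even m \<longleftrightarrow> even m'" using eq q(1)[of "m' div 2"] m by (auto simp: h_def split: if_splits)
    then show "m = m'" using d by presburger
  qed
  moreover have "h ` {..<2 * s} = \<Union>M"
  proof
    show "h ` {..<2 * s} \<subseteq> \<Union>M"
    proof (rule image_subsetI)
      fix m assume "m \<in> {..<2 * s}"
      then have "h m \<in> e (m div 2)" "m div 2 < s" using hin by auto
      then show "h m \<in> \<Union>M" using eM by blast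
    qed
    show "\<Union>M \<subseteq> h ` {..<2 * s}"
    proof
      fix v assume "v \<in> \<Union>M"
      then obtain i where i: "i < s" "v \<in> e i" using e by (auto simp: bij_betw_def)
      then have "v = h (2 * i) \<or> v = h (2 * i + 1)" using he by blast
      moreover have "2 * i < 2 * s" "2 * i + 1 < 2 * s" using i(1) by auto
      ultimately show "v \<in> h ` {..<2 * s}" by blast
    qed
  qed
  moreover have "bij_betw (\<lambda>i. {h (2 * i), h (2 * i + 1)}) {..<s} M"
    using e he by (subst bij_betw_cong[of _ _ e]) auto
  ultimately show thesis using that by (simp add: bij_betw_def)
qed

text \<open>Without missing pairs the graph is determined by its class sizes and the matching in
  class \<open>0\<close>. Bijections chosen class by class therefore suffice, provided that the one
  on class \<open>0\<close> respects the pairing.\<close>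

lemma graph_iso_matching_multipartite:
  fixes f :: "'a \<Rightarrow> nat"
  assumes "finite V" "E \<subseteq> [V]\<^bsup>2\<^esup>" "f \<in> V \<rightarrow> {..<p}" "p > 0" "missing V E f = {}"
    "card (mono_edges E f) = s" "pairwise disjnt (mono_edges E f)"
    "\<And>e. e \<in> mono_edges E f \<Longrightarrow> f ` e = {0}"
    "card {v\<in>V. f v = 0} = a" "\<And>j. j < p \<Longrightarrow> j \<noteq> 0 \<Longrightarrow> card {v\<in>V. f v = j} = b"
  shows "graph_iso \<lparr>verts = V, edges = E\<rparr> (matching_multipartite p a b s)"
\<comment> \<open>The bijection is built from the model to the graph, since the model has explicit
  labels.\<close>
proof (rule graph_iso_sym)
  let ?M = "mono_edges E f" let ?P = "\<lambda>j. {v\<in>V. f v = j}" let ?G = "matching_multipartite p a b s"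
  have finM: "finite ?M" using finite_edges[OF assms(1,2)] mono_edges_subset finite_subset by metis
  have M2: "\<exists>x y. x \<noteq> y \<and> e = {x, y}" if "e \<in> ?M" for e
  proof -
    have "e \<in> E" using that mono_edges_subset by blast
    then show ?thesis using assms(2) by (blast elim: edgeE)
  qed
  obtain h where h: "bij_betw h {..<2 * s} (\<Union>?M)" "bij_betw (\<lambda>i. {h (2 * i), h (2 * i + 1)}) {..<s} ?M"
    by (rule pairing_bij[OF finM assms(6,7) M2], assumption, rule that)
  have sub: "\<Union>?M \<subseteq> ?P 0"
    using assms(2,8) mono_edges_subset[of E f] by (fastforce simp: nsets_def)
  have cM: "card (\<Union>?M) = 2 * s" using bij_betw_same_card[OF h(1)] by simp
  then have sa: "2 * s \<le> a" using card_mono[OF _ sub] assms(1,9) by simp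
  have "card (?P 0 - \<Union>?M) = card {2 * s..<a}"
    using assms(1,9) sub cM finite_subset[OF sub] by (simp add: card_Diff_subset)
  then obtain h' where h': "bij_betw h' {2 * s..<a} (?P 0 - \<Union>?M)"
    using finite_same_card_bij[of "{2 * s..<a}" "?P 0 - \<Union>?M"] assms(1) by auto
  \<comment> \<open>The labels below \<open>2 * s\<close> go to the matched vertices, the others
    arbitrarily to the rest of class \<open>0\<close>.\<close>
  define \<psi> where "\<psi> m = (if m < 2 * s then h m else h' m)" for m
  have "bij_betw \<psi> ({..<2 * s} \<union> {2 * s..<a}) (\<Union>?M \<union> (?P 0 - \<Union>?M))"
  proof (rule bij_betw_combine)
    show "bij_betw \<psi> {..<2 * s} (\<Union>?M)"
      using h(1) by (subst bij_betw_cong[of _ _ h]) (auto simp: \<psi>_def)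
    show "bij_betw \<psi> {2 * s..<a} (?P 0 - \<Union>?M)"
      using h' by (subst bij_betw_cong[of _ _ h']) (auto simp: \<psi>_def)
  qed auto
  moreover have "{..<2 * s} \<union> {2 * s..<a} = {..<a}" using sa by auto
  moreover have "\<Union>?M \<union> (?P 0 - \<Union>?M) = ?P 0" using sub by blast
  ultimately have \<psi>: "bij_betw \<psi> {..<a} (?P 0)" by simp
  have "\<exists>\<chi>. bij_betw \<chi> {..<b} (?P j)" if "j < p" "j \<noteq> 0" for j
    using finite_same_card_bij[of "{..<b}" "?P j"] assms(1,10) that by auto
  then obtain \<chi> where \<chi>: "\<And>j. j < p \<Longrightarrow> j \<noteq> 0 \<Longrightarrow> bij_betw (\<chi> j) {..<b} (?P j)" by metis
  define \<phi> where "\<phi> j = (if j = 0 then \<psi> else \<chi> j)" for j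
  have \<phi>: "bij_betw (\<phi> j) {..<if j = 0 then a else b} (?P j)" if "j < p" for j
    using \<psi> \<chi> that by (auto simp: \<phi>_def)
  define \<Phi> where "\<Phi> = (\<lambda>(j, m). \<phi> j m)"
  have \<Phi>V: "\<Phi> x \<in> V" "f (\<Phi> x) = fst x" if "x \<in> verts ?G" for x
    using \<phi>[of "fst x"] that bij_betwE by (fastforce simp: \<Phi>_def verts_matching_multipartite split: prod.splits)+
  have bij: "bij_betw \<Phi> (verts ?G) V"
  proof (rule bij_betw_imageI)
    show "inj_on \<Phi> (verts ?G)"
    proof (rule inj_onI)
      fix x y assume xy: "x \<in> verts ?G" "y \<in> verts ?G" "\<Phi> x = \<Phi> y"
      then have fst: "fst x = fst y" using \<Phi>V(2) by metis
      have "fst x < p" "snd x \<in> {..<if fst x = 0 then a else b}" "snd y \<in> {..<if fst x = 0 then a else b}"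
        using xy(1,2) fst by (auto simp: verts_matching_multipartite)
      moreover have "\<phi> (fst x) (snd x) = \<phi> (fst x) (snd y)"
        using xy(3) fst by (simp add: \<Phi>_def split_beta)
      ultimately have "snd x = snd y"
        using \<phi>[of "fst x"] unfolding bij_betw_def by (blast dest: inj_onD)
      then show "x = y" using fst by (simp add: prod_eq_iff)
    qed
    show "\<Phi> ` verts ?G = V"
    proof
      show "\<Phi> ` verts ?G \<subseteq> V" using \<Phi>V(1) by blast
      show "V \<subseteq> \<Phi> ` verts ?G"
      proof
        fix v assume v: "v \<in> V"
        then have fv: "f v < p" using assms(3) by auto
        then obtain m where "m < (if f v = 0 then a else b)" "v = \<phi> (f v) m"
          using \<phi>[OF fv] v by (auto simp: bij_betw_def)
        then have "(f v, m) \<in> verts ?G" "\<Phi> (f v, m) = v"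
          using fv by (auto simp: verts_matching_multipartite \<Phi>_def)
        then show "v \<in> \<Phi> ` verts ?G" by force
      qed
    qed
  qed
  have pair: "{\<psi> m, \<psi> m'} \<in> E \<longleftrightarrow> (\<exists>i<s. {m, m'} = {2 * i, 2 * i + 1})" if m: "m < a" "m' < a" for m m'
  proof -
    have inj: "inj_on \<psi> {..<a}" and col: "f (\<psi> m) = 0" "f (\<psi> m') = 0"
      using \<psi> m by (auto simp: bij_betw_def)
    have M: "?M = (\<lambda>i. {h (2 * i), h (2 * i + 1)}) ` {..<s}"
      using h(2) by (simp add: bij_betw_def)
    have "{\<psi> m, \<psi> m'} \<in> E \<longleftrightarrow> {\<psi> m, \<psi> m'} \<in> ?M" using col by simp
    also have "\<dots> \<longleftrightarrow> (\<exists>i<s. {\<psi> m, \<psi> m'} = {h (2 * i), h (2 * i + 1)})"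
      unfolding M by (auto simp: image_iff)
    also have "\<dots> \<longleftrightarrow> (\<exists>i<s. \<psi> ` {m, m'} = \<psi> ` {2 * i, 2 * i + 1})"
      by (intro ex_cong1 conj_cong) (auto simp: \<psi>_def)
    also have "\<dots> \<longleftrightarrow> (\<exists>i<s. {m, m'} = {2 * i, 2 * i + 1})"
    proof (intro ex_cong1 conj_cong refl)
      fix i assume "i < s"
      then have "2 * i < a" "2 * i + 1 < a" using sa by auto
      then show "\<psi> ` {m, m'} = \<psi> ` {2 * i, 2 * i + 1} \<longleftrightarrow> {m, m'} = {2 * i, 2 * i + 1}"
        using m by (intro inj_on_image_eq_iff[OF inj]) auto
    qed
    finally show ?thesis .
  qed
  have "{x, y} \<in> edges ?G \<longleftrightarrow> {\<Phi> x, \<Phi> y} \<in> E" if xy: "x \<in> verts ?G" "y \<in> verts ?G" for x y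
  proof (cases "fst x = fst y")
    case False
    then have "(\<Phi> x, \<Phi> y) \<in> arcs E" using assms(5) \<Phi>V[OF xy(1)] \<Phi>V[OF xy(2)]
      by (auto simp: missing_def cross_def)
    then show ?thesis using xy False by (auto simp: edge_matching_multipartite_iff arcs_def)
  next
    case same: True
    show ?thesis
    proof (cases "fst x = 0")
      case True
      obtain m m' where m: "x = (0, m)" "y = (0, m')" using True same by (cases x; cases y) auto
      have "m < a" "m' < a" using xy m by (auto simp: verts_matching_multipartite)
      from pair[OF this] show ?thesis
        using m by (auto simp: edge_matching_multipartite_iff \<Phi>_def \<phi>_def doubleton_eq_iff)
    next
      case False
      have "{\<Phi> x, \<Phi> y} \<notin> E"
      proof
        assume "{\<Phi> x, \<Phi> y} \<in> E"
        then have "{\<Phi> x, \<Phi> y} \<in> ?M" using \<Phi>V(2)[OF xy(1)] \<Phi>V(2)[OF xy(2)] same by simp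
        from assms(8)[OF this] show False using \<Phi>V(2)[OF xy(1)] False by auto
      qed
      moreover have "{x, y} \<notin> edges ?G"
        using same False by (auto simp: edge_matching_multipartite_iff doubleton_eq_iff)
      ultimately show ?thesis by simp
    qed
  qed
  then show "graph_iso ?G \<lparr>verts = V, edges = E\<rparr>"
    unfolding graph_iso_def using bij by auto
qed

context coloured_graph
begin

text \<open>A class of maximal deviation uses up all of \<open>D\<close>, so the others have no
  spread and all have size \<open>n_minus\<close>. Their negative deviation shows that every
  monochromatic edge lies in the large class.\<close>

lemma extremal_conclusion:
  assumes "missing V E f = {}" "card B = s" "s > 0" "pairwise disjnt B"
    and devB: "\<And>e. e \<in> B \<Longrightarrow> dev V f p (col e) = (real p - 1) * R (p + 1) n s t / p"
    and D: "D = (R (p + 1) n s t)\<^sup>2 * (real p - 1) / p" and r: "R (p + 1) n s t > 0"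
  shows "real s * n_minus (p + 1) n s t ^ (u + 2) \<le> N"
    and "graph_iso \<lparr>verts = V, edges = E\<rparr> (KM n (p + 1) s t)"
proof -
  define r where "r = R (p + 1) n s t"
  have r0: "r > 0" using assms(7) by (simp add: r_def)
  obtain e\<^sub>0 where e0: "e\<^sub>0 \<in> B" using assms(2,3) by fastforce
  define i where "i = col e\<^sub>0"
  have i: "i < p" "dev V f p i = (real p - 1) * r / p"
    using e0 col_less devB by (auto simp: i_def r_def)
  have p1: "real p - 1 > 0" using p_pos by simp
  have "(\<Sum>j\<in>{..<p} - {i}. (dev V f p j + dev V f p i / (real p - 1))\<^sup>2) = 0"
  proof -
    have "p * (dev V f p i)\<^sup>2 / (real p - 1) = r\<^sup>2 * (real p - 1) / p"
      using p_pos p1 unfolding i(2) by (simp add: field_simps power2_eq_square)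
    then show ?thesis
      using sum_zero_square_identity[OF sum_dev[OF finV f p_pos(1)] i(1)] p_pos D
      by (simp add: r_def)
  qed
  then have "dev V f p j + dev V f p i / (real p - 1) = 0" if "j < p" "j \<noteq> i" for j
    using that by (subst (asm) sum_nonneg_eq_0_iff) auto
  moreover have "dev V f p i / (real p - 1) = r / p" using p1 unfolding i(2) by simp
  ultimately have devj: "dev V f p j = - r / p" if "j < p" "j \<noteq> i" for j using that by fastforce
  have col: "col e = i" if "e \<in> B" for e
  proof (rule ccontr)
    assume "col e \<noteq> i"
    then have "(real p - 1) * r / p = - r / p" using devj[OF col_less[OF that]] devB[OF that] by (simp add: r_def)
    then show False using r0 p_pos by (simp add: field_simps)
  qed
  have cj: "real (card {v\<in>V. f v = j}) = n_minus (p + 1) n s t" if "j < p" "j \<noteq> i" for j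
    unfolding n_minus_eq using card_part[of j] devj[OF that] by (simp add: r_def)
  have ci: "real (card {v\<in>V. f v = i}) = n_plus (p + 1) n s t"
    using card_part[of i] i(2) by (simp add: n_plus_def r_def add_divide_distrib)
  have "n_minus (p + 1) n s t ^ (u + 2) \<le> real (card (ext e))" if eB: "e \<in> B" for e
  proof -
    obtain v w where e: "e = {v, w}" "v \<noteq> w" "v \<in> V" "w \<in> V" "f v = f w" "f v < p" "{v, w} \<in> E"
      using eB by (rule B_E)
    have fv: "f v = i" using col[OF eB] e by simp
    obtain a where a: "(\<Prod>j\<in>{..<p} - {f v}. real (a j)) \<le> real (card (ext e)) + M * real n ^ u"
      "\<And>j. j < p \<Longrightarrow> j \<noteq> f v \<Longrightarrow> real (card {z\<in>V. f z = j}) - md v - md w \<le> real (a j)"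
      "\<And>j. a j \<le> card {z\<in>V. f z = j}"
      "real n - real (card {z\<in>V. f z = f v}) - md v - md w \<le> (\<Sum>j\<in>{..<p} - {f v}. real (a j))"
      by (rule ext_lower[OF e]) (rule that)
    have "md v = 0" "md w = 0" using md_le_M[OF e(3)] md_le_M[OF e(4)] assms(1) by auto
    then have aj: "n_minus (p + 1) n s t \<le> real (a j)" "0 \<le> n_minus (p + 1) n s t"
      if "j \<in> {..<p} - {i}" for j
      using a(2)[of j] cj[of j, symmetric] that fv by auto
    have "n_minus (p + 1) n s t ^ (u + 2) = (\<Prod>j\<in>{..<p} - {i}. n_minus (p + 1) n s t)"
      using card_colours[OF i(1)] by simp
    also have "\<dots> \<le> (\<Prod>j\<in>{..<p} - {i}. real (a j))" using aj by (intro prod_mono) auto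
    also have "\<dots> \<le> real (card (ext e))" using a(1) fv assms(1) by simp
    finally show ?thesis .
  qed
  then have "real (card B) * n_minus (p + 1) n s t ^ (u + 2) \<le> (\<Sum>e\<in>B. real (card (ext e)))"
    by (rule sum_bounded_below)
  also have "\<dots> \<le> N" by (rule sum_N) simp
  finally show "real s * n_minus (p + 1) n s t ^ (u + 2) \<le> N" using assms(2) by simp
  \<comment> \<open>The transposition of \<open>0\<close> and \<open>i\<close> moves the large class
    to colour \<open>0\<close>, where the model has its matching.\<close>
  define \<pi> where "\<pi> j = (if j = 0 then i else if j = i then 0 else j)" for j
  define f' where "f' = \<pi> \<circ> f"
  have \<pi>: "\<pi> j < p \<longleftrightarrow> j < p" "\<pi> (\<pi> j) = j" "\<pi> i = 0" "\<pi> 0 = i" "\<pi> j = \<pi> j' \<longleftrightarrow> j = j'" for j j'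
    using i(1) p_pos(1) by (auto simp: \<pi>_def)
  have part: "{v\<in>V. f' v = j} = {v\<in>V. f v = \<pi> j}" for j
    using \<pi>(2) by (auto simp: f'_def)
  have mono: "mono_edges E f' = B"
  proof -
    have "(\<exists>j. f' ` e \<subseteq> {j}) \<longleftrightarrow> (\<exists>j. f ` e \<subseteq> {j})" for e
      using \<pi>(5) by (auto simp: f'_def image_subset_iff) metis
    then show ?thesis by (simp add: mono_edges_def)
  qed
  have "graph_iso \<lparr>verts = V, edges = E\<rparr> (matching_multipartite p
    (nat \<lfloor>n_plus (p + 1) n s t\<rfloor>) (nat \<lfloor>n_minus (p + 1) n s t\<rfloor>) s)"
  proof (rule graph_iso_matching_multipartite[where f = f'])
    show "f' \<in> V \<rightarrow> {..<p}" using f \<pi>(1) by (auto simp: f'_def)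
    have "cross V f' = cross V f" using \<pi>(5) by (auto simp: cross_def f'_def)
    then show "missing V E f' = {}" using assms(1) by (simp add: missing_def)
    show "f' ` e = {0}" if "e \<in> mono_edges E f'" for e
    proof -
      have "e \<in> B" using that mono by simp
      moreover from this have "f ` e = {i}" using col[of e] by (auto elim!: B_E)
      ultimately show ?thesis using \<pi>(3) by (simp add: f'_def flip: image_image image_comp)
    qed
    \<comment> \<open>Here \<open>n_plus\<close> and \<open>n_minus\<close> are sizes of classes,
      hence natural numbers, and the floors are exact.\<close>
    show "card {v\<in>V. f' v = 0} = nat \<lfloor>n_plus (p + 1) n s t\<rfloor>"
      unfolding part \<pi>(4) ci[symmetric] by simp
    show "card {v\<in>V. f' v = j} = nat \<lfloor>n_minus (p + 1) n s t\<rfloor>" if "j < p" "j \<noteq> 0" for j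
    proof -
      have "\<pi> j < p" "\<pi> j \<noteq> i" using \<pi> that by metis+
      from cj[OF this, symmetric] show ?thesis unfolding part by simp
    qed
  qed (use finV E p_pos assms(2,4) mono in auto)
  then show "graph_iso \<lparr>verts = V, edges = E\<rparr> (KM n (p + 1) s t)"
    unfolding KM_eq by simp
qed

end

section \<open>The inequality and its equality case\<close>

theorem theorem1p6:
  fixes s t k :: nat
  assumes "s > t" and "t \<ge> 1" and "k \<ge> 4"
  shows "\<exists>n2::nat. \<forall>n\<ge>n2. real s > 2 * R k n s t \<longrightarrow>
    (\<forall>G :: 'a ugraph.
       simple_graph G \<and> card (verts G) = n \<and>
       card (edges G) = turan_number (k - 1) n + t \<and> \<tau> k G = s \<longrightarrow>
         real (N_cliques k G) \<ge> real s * n_minus k n s t ^ (k - 2) \<and>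
         (n_minus k n s t \<in> \<nat> \<longrightarrow>
            (real (N_cliques k G) = real s * n_minus k n s t ^ (k - 2)
               \<longleftrightarrow> graph_iso G (KM n k s t))))"
proof -
  define u where "u = k - 4"
  define p where "p = u + 3"
  have k: "k = p + 1" "k - 1 = p" "k - 2 = u + 2" using assms(3) by (auto simp: p_def u_def)
  have ev: "\<forall>\<^sub>F n in sequentially. n > 0 \<and> (\<forall>(V :: 'a set) E.
    finite V \<and> E \<subseteq> [V]\<^bsup>2\<^esup> \<and> card V = n \<and> card E = turan_number p n + t \<and>
    \<tau> (p + 1) \<lparr>verts = V, edges = E\<rparr> = s \<and> real s > 2 * R (p + 1) n s t \<and>
    real (N_cliques (p + 1) \<lparr>verts = V, edges = E\<rparr>) \<le> real s * n_minus (p + 1) n s t ^ (u + 2)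
    \<longrightarrow> (\<exists>f \<in> V \<rightarrow> {..<p}. missing V E f = {} \<and> card (mono_edges E f) = s \<and>
      pairwise disjnt (mono_edges E f) \<and>
      (\<forall>e\<in>mono_edges E f. dev V f p (the_elem (f ` e)) = (real p - 1) * R (p + 1) n s t / p) \<and>
      (\<Sum>j<p. (dev V f p j)\<^sup>2) = (R (p + 1) n s t)\<^sup>2 * (real p - 1) / p))"
    using eventually_conj[OF eventually_gt_at_top[of 0] few_cliques_structure[OF assms(1), of u, folded p_def]] .
  then obtain n2 where n2: "\<And>n (V :: 'a set) E. n2 \<le> n \<Longrightarrow> finite V \<Longrightarrow> E \<subseteq> [V]\<^bsup>2\<^esup> \<Longrightarrow> card V = n \<Longrightarrow>
    card E = turan_number p n + t \<Longrightarrow> \<tau> (p + 1) \<lparr>verts = V, edges = E\<rparr> = s \<Longrightarrow> real s > 2 * R (p + 1) n s t \<Longrightarrow>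
    real (N_cliques (p + 1) \<lparr>verts = V, edges = E\<rparr>) \<le> real s * n_minus (p + 1) n s t ^ (u + 2)
    \<Longrightarrow> n > 0 \<and> (\<exists>f \<in> V \<rightarrow> {..<p}. missing V E f = {} \<and> card (mono_edges E f) = s \<and>
      pairwise disjnt (mono_edges E f) \<and>
      (\<forall>e\<in>mono_edges E f. dev V f p (the_elem (f ` e)) = (real p - 1) * R (p + 1) n s t / p) \<and>
      (\<Sum>j<p. (dev V f p j)\<^sup>2) = (R (p + 1) n s t)\<^sup>2 * (real p - 1) / p)"
    unfolding eventually_sequentially by blast
  show ?thesis unfolding k(2,3) unfolding k(1)
  proof (intro exI[of _ n2] allI impI, elim conjE)
    fix n and G :: "'a ugraph"
    assume n: "n2 \<le> n" and sR: "real s > 2 * R (p + 1) n s t" and G: "simple_graph G" "card (verts G) = n"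
      "card (edges G) = turan_number p n + t" "\<tau> (p + 1) G = s"
    let ?m = "real s * n_minus (p + 1) n s t ^ (u + 2)"
    define V E where "V = verts G" and "E = edges G"
    have G_eq: "G = \<lparr>verts = V, edges = E\<rparr>" by (simp add: V_def E_def)
    have VE: "finite V" "E \<subseteq> [V]\<^bsup>2\<^esup>" "card V = n" "card E = turan_number p n + t"
      "\<tau> (p + 1) \<lparr>verts = V, edges = E\<rparr> = s"
      using G unfolding G_eq by (auto simp: simple_graph_def)
    \<comment> \<open>Assuming at most \<open>?m\<close> copies serves two ends: it gives the
      inequality, which is trivial otherwise, and the isomorphism in the case of equality.\<close>
    have few: "?m \<le> real (N_cliques (p + 1) G) \<and> graph_iso G (KM n (p + 1) s t)"
      if few: "real (N_cliques (p + 1) G) \<le> ?m"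
    proof -
      from n2[OF n VE sR few[unfolded G_eq]] obtain f where f: "n > 0" "f \<in> V \<rightarrow> {..<p}" "missing V E f = {}"
        "card (mono_edges E f) = s" "pairwise disjnt (mono_edges E f)"
        "\<And>e. e \<in> mono_edges E f \<Longrightarrow> dev V f p (the_elem (f ` e)) = (real p - 1) * R (p + 1) n s t / p"
        "(\<Sum>j<p. (dev V f p j)\<^sup>2) = (R (p + 1) n s t)\<^sup>2 * (real p - 1) / p" by blast
      interpret cg: coloured_graph V E f p u n s t
        by unfold_locales (use f VE p_def in auto)
      have "R (p + 1) n s t > 0" by (rule R_props) (use assms p_def in auto)
      from cg.extremal_conclusion[OF f(3,4) _ f(5-7) this] show ?thesis
        using assms(1) unfolding G_eq by simp
    qed
    show "real (N_cliques (p + 1) G) \<ge> ?m \<and> (n_minus (p + 1) n s t \<in> \<nat> \<longrightarrow>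
        (real (N_cliques (p + 1) G) = ?m \<longleftrightarrow> graph_iso G (KM n (p + 1) s t)))"
    proof (intro conjI impI iffI)
      show ge: "?m \<le> real (N_cliques (p + 1) G)" using few by linarith
      show "graph_iso G (KM n (p + 1) s t)" if "real (N_cliques (p + 1) G) = ?m"
        using few that by simp
      \<comment> \<open>For the converse, the copies in the model number at most
        \<open>s * b ^ (u + 2)\<close>, and the general inequality gives the opposite bound.\<close>
      assume nat: "n_minus (p + 1) n s t \<in> \<nat>" and iso: "graph_iso G (KM n (p + 1) s t)"
      obtain b where b: "n_minus (p + 1) n s t = real b" using nat by (rule Nats_cases)
      have KM: "KM n (p + 1) s t = matching_multipartite p (nat \<lfloor>n_plus (p + 1) n s t\<rfloor>) b s"
        using KM_eq[of n "p + 1" s t] b by simp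
      have p: "p > 0" "p - 1 = u + 2" by (simp_all add: p_def)
      have "N_cliques (p + 1) G \<le> N_cliques (p + 1) (KM n (p + 1) s t)"
        by (rule N_cliques_iso_le[OF iso]) (simp add: KM_eq verts_matching_multipartite)
      also have "\<dots> \<le> s * b ^ (u + 2)"
        using N_cliques_matching_multipartite_le[of p "nat \<lfloor>n_plus (p + 1) n s t\<rfloor>" b s]
        unfolding KM p(2) using p(1) by simp
      finally have "real (N_cliques (p + 1) G) \<le> real (s * b ^ (u + 2))" by (rule of_nat_mono)
      then show "real (N_cliques (p + 1) G) = ?m" using ge unfolding b of_nat_mult of_nat_power by linarith
    qed
  qed
qed

end
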